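(* Let $\mathcal{H}$ be a complex Hilbert space and $B,C\in\mathcal{B}(\mathcal{H})$. Then $$w\left(\begin{bmatrix}0 & B\\ C & 0\end{bmatrix}\right)\le \frac12\max\{\|B\|,\|C\|\}+\frac12\max\left\{r^{1/2}(|B||C^*|),\,r^{1/2}(|B^*||C|)\right\}.$$
   Context: $\mathcal{B}(\mathcal{H})$ is the algebra of bounded linear operators on $\mathcal{H}$ with operator norm $\|\cdot\|$. For $A\in\mathcal{B}(\mathcal{H})$, $A^*$ is the adjoint, $|A|=(A^*A)^{1/2}$, $|A^*|=(AA^* )^{1/2}$, $w(A)=\sup_{\|x\|=1}|\langle Ax,x\rangle|$ is the numerical radius, and $r(A)$ is the spectral radius. For $A,B,C,D\in\mathcal{B}(\mathcal{H})$, the operator matrix $\begin{bmatrix}A&B\\C&D\end{bmatrix}$ is the operator on $\mathcal{H}\oplus\mathcal{H}$ given by $(x_1,x_2)\mapsto(Ax_1+Bx_2,\,Cx_1+Dx_2)$; $0$ denotes the zero operator. *)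

theory Defs
  imports "HOL-Analysis.Analysis"
begin

class chilbert = banach +
  fixes scaleC :: "complex \<Rightarrow> 'a \<Rightarrow> 'a"
    and cinner :: "'a \<Rightarrow> 'a \<Rightarrow> complex"
  assumes scaleC_add_right: "scaleC a (x + y) = scaleC a x + scaleC a y"
    and scaleC_add_left: "scaleC (a + b) x = scaleC a x + scaleC b x"
    and scaleC_scaleC: "scaleC a (scaleC b x) = scaleC (a * b) x"
    and scaleC_one: "scaleC 1 x = x"
    and scaleC_of_real: "scaleC (complex_of_real r) x = scaleR r x"
    and cinner_commute: "cinner x y = cnj (cinner y x)"
    and cinner_add_left: "cinner (x + y) z = cinner x z + cinner y z"
    and cinner_scaleC_left: "cinner (scaleC c x) y = cnj c * cinner x y"
    and cinner_self: "cinner x x = complex_of_real ((norm x)\<^sup>2)"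

text \<open>The direct sum H \<oplus> H (Hilbert norm sqrt(norm x1^2 + norm x2^2) as in HOL-Analysis).\<close>

instantiation prod :: (chilbert, chilbert) chilbert
begin

definition scaleC_prod_def:
  "scaleC c p = (scaleC c (fst p), scaleC c (snd p))"

definition cinner_prod_def:
  "cinner p q = cinner (fst p) (fst q) + cinner (snd p) (snd q)"

instance
proof
  fix a b :: complex and x y z :: "'a \<times> 'b" and r :: real
  show "scaleC a (x + y) = scaleC a x + scaleC a y"
    by (simp add: scaleC_prod_def scaleC_add_right)
  show "scaleC (a + b) x = scaleC a x + scaleC b x"
    by (simp add: scaleC_prod_def scaleC_add_left)
  show "scaleC a (scaleC b x) = scaleC (a * b) x"
    by (simp add: scaleC_prod_def scaleC_scaleC)
  show "scaleC 1 x = x"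
    by (simp add: scaleC_prod_def scaleC_one)
  show "scaleC (complex_of_real r) x = scaleR r x"
    by (simp add: scaleC_prod_def scaleC_of_real scaleR_prod_def)
  show "cinner x y = cnj (cinner y x)"
    by (simp add: cinner_prod_def cinner_commute[of "fst x"] cinner_commute[of "snd x"])
  show "cinner (x + y) z = cinner x z + cinner y z"
    by (simp add: cinner_prod_def cinner_add_left)
  show "cinner (scaleC a x) y = cnj a * cinner x y"
    by (simp add: cinner_prod_def scaleC_prod_def cinner_scaleC_left distrib_left)
  show "cinner x x = complex_of_real ((norm x)\<^sup>2)"
    by (simp add: cinner_prod_def cinner_self norm_prod_def)
qed

end

definition bounded_op :: "('a::chilbert \<Rightarrow> 'b::chilbert) \<Rightarrow> bool" where
  "bounded_op T \<longleftrightarrow>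
     (\<forall>x y. T (x + y) = T x + T y) \<and> (\<forall>c x. T (scaleC c x) = scaleC c (T x)) \<and>
     (\<exists>K. \<forall>x. norm (T x) \<le> norm x * K)"

definition adjoint :: "('a::chilbert \<Rightarrow> 'a) \<Rightarrow> ('a \<Rightarrow> 'a)" where
  "adjoint T = (THE S. \<forall>x y. cinner (T x) y = cinner x (S y))"

definition positive_op :: "('a::chilbert \<Rightarrow> 'a) \<Rightarrow> bool" where
  "positive_op S \<longleftrightarrow> bounded_op S \<and>
     (\<forall>x. cinner (S x) x \<in> \<real> \<and> 0 \<le> Re (cinner (S x) x))"

definition op_sqrt :: "('a::chilbert \<Rightarrow> 'a) \<Rightarrow> ('a \<Rightarrow> 'a)" where
  "op_sqrt A = (THE S. positive_op S \<and> S \<circ> S = A)"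

definition op_abs :: "('a::chilbert \<Rightarrow> 'a) \<Rightarrow> ('a \<Rightarrow> 'a)" where
  "op_abs A = op_sqrt (adjoint A \<circ> A)"

definition op_abs_adj :: "('a::chilbert \<Rightarrow> 'a) \<Rightarrow> ('a \<Rightarrow> 'a)" where
  "op_abs_adj A = op_sqrt (A \<circ> adjoint A)"

definition op_spectrum :: "('a::chilbert \<Rightarrow> 'a) \<Rightarrow> complex set" where
  "op_spectrum T = {l. \<not> (\<exists>S. bounded_op S \<and>
      (\<forall>x. S (T x - scaleC l x) = x) \<and> (\<forall>x. T (S x) - scaleC l (S x) = x))}"

text \<open>Spectral radius; the supremum of the empty set is taken to be 0.\<close>
definition spectral_radius :: "('a::chilbert \<Rightarrow> 'a) \<Rightarrow> real" where
  "spectral_radius T = Sup (insert 0 (cmod ` op_spectrum T))"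

text \<open>Numerical radius; the supremum of the empty set (zero space) is taken to be 0.\<close>
definition numerical_radius :: "('a::chilbert \<Rightarrow> 'a) \<Rightarrow> real" where
  "numerical_radius T = Sup (insert 0 {cmod (cinner (T x) x) | x. norm x = 1})"

definition block_op :: "('a::chilbert \<Rightarrow> 'a) \<Rightarrow> ('a \<Rightarrow> 'a) \<Rightarrow> ('a \<Rightarrow> 'a) \<Rightarrow> ('a \<Rightarrow> 'a)
    \<Rightarrow> ('a \<times> 'a \<Rightarrow> 'a \<times> 'a)" where
  "block_op A B C D = (\<lambda>(x1, x2). (A x1 + B x2, C x1 + D x2))"

end

theory Submission
  imports Defs
begin

text \<open>For a unit vector \<open>(x, y)\<close> the form of the block operator is \<open>\<langle>B y, x\<rangle> + \<langle>C x, y\<rangle>\<close>. The mixed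
  Schwarz inequality \<open>|\<langle>T u, v\<rangle>|\<^sup>2 \<le> \<langle>|T| u, u\<rangle> \<langle>|T*| v, v\<rangle>\<close> and the inequality of arithmetic and
  geometric means bound its modulus by
  \<open>(\<langle>(|B| + |C*|) y, y\<rangle> + \<langle>(|B*| + |C|) x, x\<rangle>) / 2\<close>. For positive \<open>P\<close>, \<open>Q\<close> with square roots
  \<open>a\<close>, \<open>b\<close>, expanding \<open>norm (a u + b v) ^ 2\<close> with \<open>u = a x\<close>, \<open>v = b x\<close> gives
  \<open>P + Q \<le> max (norm P) (norm Q) + norm (a b)\<close>, and
  \<open>norm (a b) ^ 2 = norm (b P b) = r (b P b) = r (P Q)\<close>.\<close>

section \<open>Inner product calculus\<close>

text \<open>The adjoint and the square root are definite descriptions, so existence and uniqueness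
  must be established before any estimate applies. The adjoint comes from Riesz representation, the
  root from the binomial series of \<open>sqrt (1 - t)\<close> evaluated at a contraction. An
  explicit series also transports roots: if \<open>B P = Q B\<close>, then \<open>B\<close> carries
  the root of \<open>P\<close> to the root of \<open>Q\<close>. Starting from the associativity of
  \<open>B\<close>, \<open>adjoint B\<close>, \<open>B\<close>, this gives
  \<open>B |B| = |B*| B\<close> and takes the place of a polar decomposition in the mixed Schwarz
  inequality. On the spectral side only \<open>norm (b P b) <= r (P Q)\<close> is required. Instead
  of Gelfand's formula it suffices that a nonzero positive operator has its norm as a spectral value
  and that nonzero spectral values survive exchanging two factors.\<close>

lemma cinner_add_right: "cinner x (y + z) = cinner x y + cinner x (z::'a::chilbert)"
  by (metis cinner_add_left cinner_commute complex_cnj_add)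

lemma cinner_scaleC_right: "cinner x (scaleC c y) = c * cinner x (y::'a::chilbert)"
  by (metis cinner_commute cinner_scaleC_left complex_cnj_cnj complex_cnj_mult)

lemma cinner_scaleR_left: "cinner (r *\<^sub>R x) y = of_real r * cinner x (y::'a::chilbert)"
  by (metis cinner_scaleC_left complex_cnj_complex_of_real scaleC_of_real)

lemma cinner_scaleR_right: "cinner x (r *\<^sub>R y) = of_real r * cinner x (y::'a::chilbert)"
  by (metis cinner_scaleC_right scaleC_of_real)

lemma cinner_minus_left: "cinner (- x) y = - cinner x (y::'a::chilbert)"
  using cinner_scaleR_left[of "-1" x y] by simp

lemma cinner_minus_right: "cinner x (- y) = - cinner x (y::'a::chilbert)"
  using cinner_scaleR_right[of x "-1" y] by simp

lemma cinner_diff_left: "cinner (x - y) z = cinner x z - cinner y (z::'a::chilbert)"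
  using cinner_add_left[of x "- y" z] by (simp add: cinner_minus_left)

lemma cinner_diff_right: "cinner x (y - z) = cinner x y - cinner x (z::'a::chilbert)"
  using cinner_add_right[of x y "- z"] by (simp add: cinner_minus_right)

lemma cinner_zero_left [simp]: "cinner 0 (y::'a::chilbert) = 0"
  using cinner_scaleR_left[of 0 0 y] by simp

lemmas cinner_simps = cinner_add_left cinner_add_right cinner_diff_left cinner_diff_right
  cinner_scaleR_left cinner_scaleR_right cinner_scaleC_left cinner_scaleC_right
  cinner_minus_left cinner_minus_right

lemma cinner_sum_left: "cinner (sum f I) y = (\<Sum>i\<in>I. cinner (f i) (y::'a::chilbert))"
  by (induction I rule: infinite_finite_induct) (auto simp: cinner_add_left)

lemma Re_cinner_commute: "Re (cinner x y) = Re (cinner y (x::'a::chilbert))"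
  by (subst cinner_commute) simp

lemma Re_cinner_self: "Re (cinner x x) = (norm (x::'a::chilbert))\<^sup>2"
  by (simp add: cinner_self)

lemma norm_add_sq:
  "(norm (x + y))\<^sup>2 = (norm x)\<^sup>2 + 2 * Re (cinner x y) + (norm (y::'a::chilbert))\<^sup>2"
  unfolding Re_cinner_self[symmetric]
  by (simp add: cinner_simps Re_cinner_commute[of y x])

lemma norm_diff_sq:
  "(norm (x - y))\<^sup>2 = (norm x)\<^sup>2 - 2 * Re (cinner x y) + (norm (y::'a::chilbert))\<^sup>2"
  unfolding Re_cinner_self[symmetric]
  by (simp add: cinner_simps Re_cinner_commute[of y x])

lemma scaleC_zero_right [simp]: "scaleC c (0::'a::chilbert) = 0"
  by (metis add_cancel_right_right scaleC_add_right)

lemma scaleC_minus_right: "scaleC c (- x) = - scaleC c (x::'a::chilbert)"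
  by (metis add.right_inverse add_eq_0_iff scaleC_add_right scaleC_zero_right)

lemma scaleC_diff_right: "scaleC c (x - y) = scaleC c x - scaleC c (y::'a::chilbert)"
  by (metis add_uminus_conv_diff scaleC_add_right scaleC_minus_right)

lemma norm_scaleC: "norm (scaleC c x) = cmod c * norm (x::'a::chilbert)"
proof -
  have "complex_of_real ((norm (scaleC c x))\<^sup>2) = cinner (scaleC c x) (scaleC c x)"
    by (simp only: cinner_self)
  also have "\<dots> = (c * cnj c) * cinner x x"
    by (simp add: cinner_scaleC_left cinner_scaleC_right)
  also have "\<dots> = complex_of_real ((cmod c * norm x)\<^sup>2)"
    by (simp only: complex_norm_square[symmetric] cinner_self of_real_power of_real_mult
        power_mult_distrib)
  finally have "(norm (scaleC c x))\<^sup>2 = (cmod c * norm x)\<^sup>2"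
    using of_real_eq_iff by blast
  then show ?thesis
    by simp
qed

lemma unit_phase:
  obtains c where "cmod c = 1" and "c * z = of_real (cmod z)"
proof (cases "z = 0")
  case True
  then show ?thesis using that[of 1] by simp
next
  case False
  have "cnj (sgn z) * z = of_real (cmod z)"
    using False complex_norm_square[of z]
    by (simp add: sgn_eq field_simps power2_eq_square)
  then show ?thesis using that[of "cnj (sgn z)"] False by (simp add: norm_sgn)
qed

section \<open>Bounded and positive operators\<close>

lemma bounded_opI:
  assumes "\<And>x y. T (x + y) = T x + T y" "\<And>c x. T (scaleC c x) = scaleC c (T x)"
    "\<And>x. norm (T x) \<le> K * norm x"
  shows "bounded_op T"
  using assms unfolding bounded_op_def by (metis mult.commute)

lemma bounded_op_add: "bounded_op T \<Longrightarrow> T (x + y) = T x + T y"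
  by (simp add: bounded_op_def)

lemma bounded_op_scaleC: "bounded_op T \<Longrightarrow> T (scaleC c x) = scaleC c (T x)"
  by (simp add: bounded_op_def)

lemma bounded_op_scaleR: "bounded_op T \<Longrightarrow> T (r *\<^sub>R x) = r *\<^sub>R T x"
  by (metis bounded_op_scaleC scaleC_of_real)

lemma bounded_op_imp_bounded_linear: "bounded_op T \<Longrightarrow> bounded_linear T"
  unfolding bounded_linear_def bounded_linear_axioms_def linear_iff
  by (simp add: bounded_op_scaleR bounded_op_add) (simp add: bounded_op_def)

lemma bounded_op_diff: "bounded_op T \<Longrightarrow> T (x - y) = T x - T y"
  by (simp add: bounded_op_imp_bounded_linear linear_simps)

lemma bounded_op_norm: "bounded_op T \<Longrightarrow> norm (T x) \<le> onorm T * norm x"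
  by (rule onorm[OF bounded_op_imp_bounded_linear])

lemma bounded_op_onorm_nonneg: "bounded_op T \<Longrightarrow> 0 \<le> onorm T"
  by (rule onorm_pos_le[OF bounded_op_imp_bounded_linear])

lemma bounded_op_comp:
  assumes "bounded_op S" "bounded_op T"
  shows "bounded_op (S \<circ> T)"
proof (rule bounded_opI)
  show "norm ((S \<circ> T) x) \<le> onorm (S \<circ> T) * norm x" for x
    by (rule onorm)
      (simp add: assms bounded_linear_compose bounded_op_imp_bounded_linear comp_def)
qed (simp_all add: assms bounded_op_add bounded_op_scaleC)

lemma bounded_op_id: "bounded_op (\<lambda>x. x)"
  by (rule bounded_opI[where K = 1]) auto

lemma bounded_op_add_op:
  assumes "bounded_op S" "bounded_op T"
  shows "bounded_op (\<lambda>x. S x + T x)"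
proof (rule bounded_opI)
  show "norm (S x + T x) \<le> (onorm S + onorm T) * norm x" for x
    using norm_triangle_ineq[of "S x" "T x"] bounded_op_norm[OF assms(1), of x]
      bounded_op_norm[OF assms(2), of x] by (simp add: algebra_simps)
qed (simp_all add: assms bounded_op_add bounded_op_scaleC scaleC_add_right)

lemma bounded_op_scaleC_op:
  assumes "bounded_op T"
  shows "bounded_op (\<lambda>x. scaleC c (T x))"
proof (rule bounded_opI)
  show "norm (scaleC c (T x)) \<le> (cmod c * onorm T) * norm x" for x
    using mult_left_mono[OF bounded_op_norm[OF assms, of x], of "cmod c"]
    by (simp add: norm_scaleC mult.assoc)
qed (simp_all add: assms bounded_op_add bounded_op_scaleC scaleC_add_right scaleC_scaleC mult.commute)

lemma bounded_op_scaleR_op: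
  assumes "bounded_op T"
  shows "bounded_op (\<lambda>x. r *\<^sub>R T x)"
  using bounded_op_scaleC_op[OF assms, of "of_real r"] by (simp add: scaleC_of_real)

lemma bounded_op_diff_op:
  assumes "bounded_op S" "bounded_op T"
  shows "bounded_op (\<lambda>x. S x - T x)"
  using bounded_op_add_op[OF assms(1) bounded_op_scaleR_op[OF assms(2), of "-1"]] by simp

section \<open>Positive operators and their quadratic forms\<close>

lemma positive_opD:
  assumes "positive_op S"
  shows "bounded_op S" "0 \<le> Re (cinner (S x) x)" "Im (cinner (S x) x) = 0"
  using assms by (auto simp: positive_op_def complex_is_Real_iff)

lemma positive_opI:
  assumes "bounded_op S" "\<And>x. 0 \<le> Re (cinner (S x) x)" "\<And>x. Im (cinner (S x) x) = 0"
  shows "positive_op S"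
  using assms by (auto simp: positive_op_def complex_is_Real_iff)

lemma positive_op_id: "positive_op (\<lambda>x. x)"
  by (rule positive_opI) (auto simp: bounded_op_id cinner_self)

text \<open>Complex polarisation: reality of the form at \<open>u + v\<close> makes two imaginary
  parts cancel, and replacing \<open>y\<close> by \<open>scaleC \<i> y\<close> turns this into
  equality of the real parts. Self-adjointness thus follows from positivity of the form.\<close>

lemma real_form_imp_symmetric:
  assumes S: "bounded_op S" and real: "\<And>x. Im (cinner (S x) x) = 0"
  shows "cinner (S x) y = cinner x (S y)"
proof -
  have 1: "Im (cinner (S u) v) + Im (cinner (S v) u) = 0" for u v
    using real[of "u + v"] real[of u] real[of v] by (simp add: bounded_op_add[OF S] cinner_simps)
  have "Im (cinner (S x) y) = - Im (cinner (S y) x)"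
    using 1[of x y] by simp
  moreover have "Re (cinner (S x) y) = Re (cinner (S y) x)"
    using 1[of x "scaleC \<i> y"] by (simp add: bounded_op_scaleC[OF S] cinner_simps)
  ultimately have "cinner (S x) y = cnj (cinner (S y) x)"
    by (simp add: complex_eq_iff)
  then show ?thesis
    using cinner_commute by metis
qed

lemma positive_op_symmetric:
  "positive_op S \<Longrightarrow> cinner (S x) y = cinner x (S y)"
  using real_form_imp_symmetric positive_opD by blast

lemma quadratic_nonneg_imp_discriminant:
  fixes a b c :: real
  assumes "\<And>t. 0 \<le> a + 2 * t * b + t\<^sup>2 * c" "0 \<le> c"
  shows "b\<^sup>2 \<le> a * c"
proof (cases "c = 0")
  case True
  have "b = 0"
  proof (rule ccontr)
    assume "b \<noteq> 0"
    \<comment> \<open>For \<open>c = 0\<close> the polynomial is linear in \<open>t\<close>; this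
      \<open>t\<close> is where it takes the value -1.\<close>
    then show False using assms(1)[of "- (a + 1) / (2 * b)"] True by (simp add: field_simps)
  qed
  then show ?thesis using True by simp
next
  case False
  then have "c > 0" using assms by simp
  \<comment> \<open>The minimiser of the parabola.\<close>
  then show ?thesis using assms(1)[of "- b / c"]
    by (simp add: field_simps power2_eq_square)
qed

lemma positive_op_Cauchy_Schwarz:
  assumes S: "positive_op S"
  shows "(cmod (cinner (S x) y))\<^sup>2 \<le> Re (cinner (S x) x) * Re (cinner (S y) y)"
proof -
  note bS = positive_opD(1)[OF S]
  obtain c where c: "cmod c = 1" "c * cinner (S x) y = of_real (cmod (cinner (S x) y))"
    by (rule unit_phase)
  \<comment> \<open>Rotating \<open>y\<close> by the phase makes the cross term real and nonnegative
    without changing the form at \<open>y\<close>, so a real parameter \<open>t\<close>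
    suffices.\<close>
  define z where "z = scaleC c y"
  have sz: "Re (cinner (S x) z) = cmod (cinner (S x) y)"
    using c by (simp add: z_def cinner_scaleC_right)
  have "cinner (S z) z = (cnj c * c) * cinner (S y) y"
    by (simp add: z_def bounded_op_scaleC[OF bS] cinner_simps)
  also have "cnj c * c = 1"
    using c(1) complex_norm_square[of c] by (simp add: mult.commute)
  finally have zz: "cinner (S z) z = cinner (S y) y" by simp
  have sym: "Re (cinner (S z) x) = Re (cinner (S x) z)"
    using positive_op_symmetric[OF S, of z x] Re_cinner_commute by metis
  have "0 \<le> Re (cinner (S x) x) + 2 * t * Re (cinner (S x) z) + t\<^sup>2 * Re (cinner (S z) z)" for t
    using positive_opD(2)[OF S, of "x + t *\<^sub>R z"] sym
    by (simp add: bounded_op_add[OF bS] bounded_op_scaleR[OF bS] cinner_simps power2_eq_square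
        algebra_simps)
  then have "(Re (cinner (S x) z))\<^sup>2 \<le> Re (cinner (S x) x) * Re (cinner (S z) z)"
    by (intro quadratic_nonneg_imp_discriminant) (auto simp: positive_opD(2)[OF S])
  then show ?thesis by (simp add: sz zz)
qed

lemma cinner_Cauchy_Schwarz: "cmod (cinner x y) \<le> norm x * norm (y::'a::chilbert)"
proof (rule power2_le_imp_le)
  show "(cmod (cinner x y))\<^sup>2 \<le> (norm x * norm y)\<^sup>2"
    using positive_op_Cauchy_Schwarz[OF positive_op_id, of x y]
    by (simp add: Re_cinner_self power_mult_distrib)
qed auto

lemma bounded_linear_cinner_left: "bounded_linear (\<lambda>x. cnj (cinner x (y::'a::chilbert)))"
proof (rule bounded_linear_intro[where K = "norm y"])
  show "norm (cnj (cinner x y)) \<le> norm x * norm y" for x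
    using cinner_Cauchy_Schwarz by simp
qed (simp_all add: cinner_simps scaleR_conv_of_real)

lemma tendsto_cinner_left:
  assumes "(f \<longlongrightarrow> l) F"
  shows "((\<lambda>n. cinner (f n) (y::'a::chilbert)) \<longlongrightarrow> cinner l y) F"
  using tendsto_cnj[OF bounded_linear.tendsto[OF bounded_linear_cinner_left assms, of y]] by simp

text \<open>The operator inequality \<open>S S <= M S\<close>: apply Cauchy-Schwarz for the form of
  \<open>S\<close> to the pair \<open>x\<close>, \<open>S x\<close> and cancel
  \<open>(norm (S x))\<^sup>2\<close>.\<close>

lemma positive_op_norm_sq_le:
  assumes S: "positive_op S" and M: "\<And>x. Re (cinner (S x) x) \<le> M * (norm x)\<^sup>2"
  shows "(norm (S x))\<^sup>2 \<le> M * Re (cinner (S x) x)"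
proof (cases "S x = 0")
  case True
  then show ?thesis by simp
next
  case False
  have "((norm (S x))\<^sup>2)\<^sup>2 = (cmod (cinner (S x) (S x)))\<^sup>2"
    by (simp add: cinner_self norm_power)
  also have "\<dots> \<le> Re (cinner (S x) x) * Re (cinner (S (S x)) (S x))"
    by (rule positive_op_Cauchy_Schwarz[OF S])
  also have "\<dots> \<le> Re (cinner (S x) x) * (M * (norm (S x))\<^sup>2)"
    by (rule mult_left_mono[OF M positive_opD(2)[OF S]])
  finally have "(norm (S x))\<^sup>2 * (norm (S x))\<^sup>2 \<le> (M * Re (cinner (S x) x)) * (norm (S x))\<^sup>2"
    by (simp add: power2_eq_square algebra_simps)
  moreover have "0 < (norm (S x))\<^sup>2"
    using False by simp
  ultimately show ?thesis
    using mult_le_cancel_right_pos by blast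
qed

lemma positive_op_norm_le:
  assumes S: "positive_op S" and M: "\<And>x. Re (cinner (S x) x) \<le> M * (norm x)\<^sup>2" and "0 \<le> M"
  shows "norm (S x) \<le> M * norm x"
proof (rule power2_le_imp_le)
  have "(norm (S x))\<^sup>2 \<le> M * Re (cinner (S x) x)"
    by (rule positive_op_norm_sq_le[OF S M])
  also have "\<dots> \<le> M * (M * (norm x)\<^sup>2)"
    by (rule mult_left_mono[OF M \<open>0 \<le> M\<close>])
  finally show "(norm (S x))\<^sup>2 \<le> (M * norm x)\<^sup>2"
    by (simp add: power2_eq_square algebra_simps)
qed (simp add: \<open>0 \<le> M\<close>)

lemma form_le_norm:
  assumes "\<And>x. norm (S x) \<le> M * norm x"
  shows "Re (cinner (S x) x) \<le> M * (norm (x::'a::chilbert))\<^sup>2"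
proof -
  have "Re (cinner (S x) x) \<le> norm (S x) * norm x"
    using cinner_Cauchy_Schwarz complex_Re_le_cmod order_trans by blast
  also have "\<dots> \<le> (M * norm x) * norm x"
    by (rule mult_right_mono[OF assms]) simp
  finally show ?thesis by (simp add: power2_eq_square mult.assoc)
qed

section \<open>Adjoints\<close>

text \<open>The representing vector minimises \<open>norm x ^ 2 - 2 Re (f x)\<close>; by the parallelogram law
  minimising sequences are Cauchy.\<close>

lemma Riesz_representation:
  fixes f :: "'a::chilbert \<Rightarrow> complex"
  assumes add: "\<And>x y. f (x + y) = f x + f y" and scale: "\<And>c x. f (scaleC c x) = c * f x"
    and bound: "\<And>x. cmod (f x) \<le> K * norm x"
  shows "\<exists>z. \<forall>x. f x = cinner z x"
proof -
  have fR: "f (r *\<^sub>R x) = of_real r * f x" for r x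
    by (metis scale scaleC_of_real)
  have fbl: "bounded_linear f"
    by (rule bounded_linear_intro[where K = K])
      (use add fR bound in \<open>auto simp: scaleR_conv_of_real mult.commute\<close>)
  define J where "J x = (norm x)\<^sup>2 - 2 * Re (f x)" for x
  have lower: "- K\<^sup>2 \<le> J x" for x
  proof -
    have "Re (f x) \<le> K * norm x"
      using bound complex_Re_le_cmod order_trans by blast
    moreover have "0 \<le> (norm x - K)\<^sup>2" by simp
    ultimately show ?thesis by (simp add: J_def power2_diff algebra_simps)
  qed
  define d where "d = Inf (range J)"
  have bdd: "bdd_below (range J)"
    using lower by (intro bdd_belowI[of _ "- K\<^sup>2"]) auto
  have d_le: "d \<le> J x" for x
    unfolding d_def by (rule cInf_lower[OF _ bdd]) simp
  have "\<exists>x. J x < d + 1 / real (Suc n)" for n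
    using cInf_lessD[of "range J" "d + 1 / real (Suc n)"] by (auto simp: d_def)
  then obtain X where X: "\<And>n. J (X n) < d + 1 / real (Suc n)"
    by metis
  have para: "(norm (a - b))\<^sup>2 \<le> 2 * (J a + J b - 2 * d)" for a b
  proof -
    have "J ((1/2) *\<^sub>R (a + b)) = (norm (a + b))\<^sup>2 / 4 - (Re (f a) + Re (f b))"
      by (simp add: J_def fR add power_divide add_divide_distrib flip: scaleR_add_right)
    moreover have "(norm (a + b))\<^sup>2 + (norm (a - b))\<^sup>2 = 2 * (norm a)\<^sup>2 + 2 * (norm b)\<^sup>2"
      by (simp add: norm_add_sq norm_diff_sq)
    ultimately show ?thesis
      using d_le[of "(1/2) *\<^sub>R (a + b)"] by (simp add: J_def)
  qed
  have "Cauchy X"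
  proof (rule CauchyI)
    fix e :: real assume "0 < e"
    then obtain N where N: "1 / real (Suc N) < e\<^sup>2 / 4"
      using nat_approx_posE[of "e\<^sup>2 / 4"] by (metis zero_less_divide_iff zero_less_numeral zero_less_power)
    have "norm (X m - X n) < e" if "m \<ge> N" "n \<ge> N" for m n
    proof (rule power2_less_imp_less)
      have "1 / real (Suc m) \<le> 1 / real (Suc N)" "1 / real (Suc n) \<le> 1 / real (Suc N)"
        using that by (auto simp: field_simps)
      then show "(norm (X m - X n))\<^sup>2 < e\<^sup>2"
        using para[of "X m" "X n"] X[of m] X[of n] N by simp
    qed (use \<open>0 < e\<close> in simp)
    then show "\<exists>M. \<forall>m\<ge>M. \<forall>n\<ge>M. norm (X m - X n) < e" by blast
  qed
  then obtain z where z: "X \<longlonglongrightarrow> z"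
    using Cauchy_convergent_iff convergent_def by blast
  have "(\<lambda>n. J (X n)) \<longlonglongrightarrow> J z"
    unfolding J_def by (intro tendsto_intros z bounded_linear.tendsto[OF fbl z])
  moreover have "(\<lambda>n. d + 1 / real (Suc n)) \<longlonglongrightarrow> d + 0"
    by (intro tendsto_intros LIMSEQ_Suc[OF lim_1_over_n])
  ultimately have "J z \<le> d + 0"
    by (rule LIMSEQ_le) (use X less_imp_le in blast)
  then have min: "J z \<le> J x" for x
    using d_le[of x] by simp
  \<comment> \<open>First variation: along \<open>z + t *\<^sub>R x\<close> minimality leaves a
    nonnegative quadratic in \<open>t\<close> with zero constant term, so its linear coefficient
    vanishes.\<close>
  have re: "Re (f x) = Re (cinner z x)" for x
  proof -
    have "0 \<le> 0 + 2 * t * (Re (cinner z x) - Re (f x)) + t\<^sup>2 * (norm x)\<^sup>2" for t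
      using min[of "z + t *\<^sub>R x"]
      by (simp add: J_def add fR norm_add_sq cinner_simps algebra_simps)
    then have "(Re (cinner z x) - Re (f x))\<^sup>2 \<le> 0 * (norm x)\<^sup>2"
      by (intro quadratic_nonneg_imp_discriminant) auto
    then show ?thesis by simp
  qed
  have "f x = cinner z x" for x
    using re[of x] re[of "scaleC \<i> x"] by (simp add: scale cinner_simps complex_eq_iff)
  then show ?thesis by blast
qed

lemma cinner_ext:
  assumes "\<And>x. cinner x u = cinner x (v::'a::chilbert)"
  shows "u = v"
  using assms[of "u - v"] cinner_self[of "u - v"] by (simp add: cinner_simps)

text \<open>Makes the definite description \<open>adjoint\<close> usable: Riesz representation
  supplies a witness for each \<open>y\<close>, and vectors are determined by their inner
  products.\<close>

lemma cinner_adjoint: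
  fixes T :: "'a::chilbert \<Rightarrow> 'a"
  assumes T: "bounded_op T"
  shows "cinner (T x) y = cinner x (adjoint T y)"
proof -
  have "\<exists>z. \<forall>x. cinner (T x) y = cinner x z" for y
  proof -
    have "\<exists>z. \<forall>x. cinner y (T x) = cinner z x"
    proof (rule Riesz_representation[where K = "norm y * onorm T"])
      show "cmod (cinner y (T x)) \<le> norm y * onorm T * norm x" for x
        using cinner_Cauchy_Schwarz[of y "T x"]
          mult_left_mono[OF bounded_op_norm[OF T, of x] norm_ge_zero[of y]]
        by (simp add: mult.assoc)
    qed (simp_all add: bounded_op_add[OF T] bounded_op_scaleC[OF T] cinner_simps)
    then show ?thesis
      using cinner_commute by metis
  qed
  then obtain S where S: "\<And>x y. cinner (T x) y = cinner x (S y)"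
    by metis
  have "\<forall>x y. cinner (T x) y = cinner x (adjoint T y)"
    unfolding Defs.adjoint_def
  proof (rule theI[where a = S])
    fix S' assume "\<forall>x y. cinner (T x) y = cinner x (S' y)"
    then show "S' = S"
      using S by (metis cinner_ext ext)
  qed (use S in blast)
  then show ?thesis by blast
qed

lemma cinner_adjoint': "bounded_op T \<Longrightarrow> cinner (adjoint T x) y = cinner x (T y)"
  by (metis cinner_adjoint cinner_commute)

lemma norm_adjoint_le:
  assumes T: "bounded_op T"
  shows "norm (adjoint T x) \<le> onorm T * norm x"
proof (cases "adjoint T x = 0")
  case True
  then show ?thesis by (simp add: bounded_op_onorm_nonneg[OF T])
next
  case False
  have "(norm (adjoint T x))\<^sup>2 = Re (cinner (T (adjoint T x)) x)"
    by (simp add: cinner_adjoint[OF T] Re_cinner_self)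
  also have "\<dots> \<le> norm (T (adjoint T x)) * norm x"
    using cinner_Cauchy_Schwarz complex_Re_le_cmod order_trans by blast
  also have "\<dots> \<le> (onorm T * norm (adjoint T x)) * norm x"
    by (rule mult_right_mono[OF bounded_op_norm[OF T]]) simp
  finally have "norm (adjoint T x) * norm (adjoint T x) \<le> (onorm T * norm x) * norm (adjoint T x)"
    by (simp add: power2_eq_square algebra_simps)
  then show ?thesis
    using False by (simp add: mult_le_cancel_right)
qed

lemma bounded_op_adjoint:
  assumes T: "bounded_op T"
  shows "bounded_op (adjoint T)"
proof (rule bounded_opI[OF _ _ norm_adjoint_le[OF T]])
  show "adjoint T (x + y) = adjoint T x + adjoint T y" for x y
    by (rule cinner_ext) (simp add: cinner_adjoint[OF T, symmetric] cinner_simps)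
  show "adjoint T (scaleC c x) = scaleC c (adjoint T x)" for c x
    by (rule cinner_ext) (simp add: cinner_adjoint[OF T, symmetric] cinner_simps)
qed

lemma positive_op_adjoint_comp:
  assumes T: "bounded_op T"
  shows "positive_op (adjoint T \<circ> T)" "positive_op (T \<circ> adjoint T)"
proof -
  show "positive_op (adjoint T \<circ> T)"
    by (rule positive_opI)
      (simp_all add: bounded_op_comp bounded_op_adjoint T cinner_adjoint'[OF T] cinner_self)
  show "positive_op (T \<circ> adjoint T)"
    by (rule positive_opI)
      (simp_all add: bounded_op_comp bounded_op_adjoint T cinner_adjoint[OF T] cinner_self)
qed

section \<open>Power series of operators\<close>

text \<open>The sum is formed pointwise, so it converges by completeness of the underlying space,
  without a Banach space of operators.\<close>

definition op_series :: "(nat \<Rightarrow> real) \<Rightarrow> ('a::chilbert \<Rightarrow> 'a) \<Rightarrow> 'a \<Rightarrow> 'a" where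
  "op_series c K x = (\<Sum>n. c n *\<^sub>R (K ^^ n) x)"

lemma norm_funpow_le:
  fixes K :: "'a::real_normed_vector \<Rightarrow> 'a"
  assumes "\<And>x. norm (K x) \<le> q * norm x" "0 \<le> q"
  shows "norm ((K ^^ n) x) \<le> q ^ n * norm x"
proof (induction n)
  case (Suc n)
  have "norm ((K ^^ Suc n) x) \<le> q * norm ((K ^^ n) x)"
    using assms(1) by simp
  also have "\<dots> \<le> q * (q ^ n * norm x)"
    by (rule mult_left_mono[OF Suc assms(2)])
  finally show ?case by (simp add: mult.assoc)
qed simp

lemma bounded_op_funpow:
  fixes K :: "'a::chilbert \<Rightarrow> 'a"
  assumes "bounded_op K"
  shows "bounded_op (K ^^ n)"
proof (induction n)
  case 0
  show ?case using bounded_op_id by (simp add: id_def)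
next
  case (Suc n)
  then show ?case using bounded_op_comp[OF assms] by (simp add: comp_def)
qed

lemma op_series_norm_summable:
  fixes K :: "'a::chilbert \<Rightarrow> 'a"
  assumes "\<And>x. norm (K x) \<le> q * norm x" "0 \<le> q" "summable (\<lambda>n. \<bar>c n\<bar> * q ^ n)"
  shows "summable (\<lambda>n. norm (c n *\<^sub>R (K ^^ n) x))"
proof (rule summable_comparison_test')
  show "summable (\<lambda>n. (\<bar>c n\<bar> * q ^ n) * norm x)"
    by (rule summable_mult2[OF assms(3)])
  show "norm (norm (c n *\<^sub>R (K ^^ n) x)) \<le> (\<bar>c n\<bar> * q ^ n) * norm x" if "n \<ge> 0" for n
    using mult_left_mono[OF norm_funpow_le[OF assms(1,2), of n x], of "\<bar>c n\<bar>"]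
    by (simp add: mult.assoc)
qed

lemma op_series_sums:
  fixes K :: "'a::chilbert \<Rightarrow> 'a"
  assumes "\<And>x. norm (K x) \<le> q * norm x" "0 \<le> q" "summable (\<lambda>n. \<bar>c n\<bar> * q ^ n)"
  shows "(\<lambda>n. c n *\<^sub>R (K ^^ n) x) sums op_series c K x"
  unfolding op_series_def
  by (rule summable_sums[OF summable_norm_cancel[OF op_series_norm_summable[OF assms]]])

text \<open>A bounded operator passes through the sum term by term, and convergence on the side of
  \<open>L\<close> is inherited from that of \<open>K\<close>. This one fact yields homogeneity,
  commutation with \<open>K\<close>, and later the transport of square roots.\<close>

lemma op_series_intertwine:
  fixes K :: "'a::chilbert \<Rightarrow> 'a" and L :: "'b::chilbert \<Rightarrow> 'b"
  assumes "\<And>x. norm (K x) \<le> q * norm x" "0 \<le> q" "summable (\<lambda>n. \<bar>c n\<bar> * q ^ n)"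
    and B: "bounded_op B" and comm: "\<And>x. B (K x) = L (B x)"
  shows "B (op_series c K x) = op_series c L (B x)"
proof -
  have pow: "B ((K ^^ n) x) = (L ^^ n) (B x)" for n
    by (induction n) (auto simp: comm)
  have "(\<lambda>n. B (c n *\<^sub>R (K ^^ n) x)) sums B (op_series c K x)"
    by (rule bounded_linear.sums[OF bounded_op_imp_bounded_linear[OF B] op_series_sums[OF assms(1-3)]])
  then have "(\<lambda>n. c n *\<^sub>R (L ^^ n) (B x)) sums B (op_series c K x)"
    by (simp add: bounded_op_scaleR[OF B] pow)
  then show ?thesis
    by (simp add: op_series_def sums_iff)
qed

lemma bounded_op_op_series:
  fixes K :: "'a::chilbert \<Rightarrow> 'a"
  assumes K: "bounded_op K"
    and q: "\<And>x. norm (K x) \<le> q * norm x" "0 \<le> q" "summable (\<lambda>n. \<bar>c n\<bar> * q ^ n)"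
  shows "bounded_op (op_series c K)"
proof (rule bounded_opI)
  note s = op_series_sums[OF q]
  note Kn = bounded_op_funpow[OF K]
  show "op_series c K (x + y) = op_series c K x + op_series c K y" for x y
    using sums_unique2[OF s[of "x + y"]] sums_add[OF s[of x] s[of y]]
    by (simp add: bounded_op_add[OF Kn] scaleR_add_right)
  show "op_series c K (scaleC a x) = scaleC a (op_series c K x)" for a x
    using op_series_intertwine[OF q bounded_op_scaleC_op[OF bounded_op_id, of a], of K x]
    by (simp add: bounded_op_scaleC[OF K])
  show "norm (op_series c K x) \<le> (\<Sum>n. \<bar>c n\<bar> * q ^ n) * norm x" for x
  proof -
    have "norm (op_series c K x) \<le> (\<Sum>n. norm (c n *\<^sub>R (K ^^ n) x))"
      unfolding op_series_def by (rule summable_norm[OF op_series_norm_summable[OF q]])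
    also have "\<dots> \<le> (\<Sum>n. (\<bar>c n\<bar> * q ^ n) * norm x)"
    proof (rule suminf_le[OF _ op_series_norm_summable[OF q] summable_mult2[OF q(3)]])
      show "norm (c n *\<^sub>R (K ^^ n) x) \<le> (\<bar>c n\<bar> * q ^ n) * norm x" for n
        using mult_left_mono[OF norm_funpow_le[OF q(1,2), of n x], of "\<bar>c n\<bar>"]
        by (simp add: mult.assoc)
    qed
    also have "\<dots> = (\<Sum>n. \<bar>c n\<bar> * q ^ n) * norm x"
      by (rule suminf_mult2[OF q(3), symmetric])
    finally show ?thesis .
  qed
qed

text \<open>An absolutely summable double family may be summed by rows or by antidiagonals. Absolute
  summability of the coefficients stands in for a contraction factor below 1, because the root
  series is evaluated at the boundary of its disc.\<close>

lemma op_series_Cauchy_product: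
  fixes K :: "'a::chilbert \<Rightarrow> 'a"
  assumes K: "bounded_op K" and contr: "\<And>x. norm (K x) \<le> norm x"
    and a: "summable (\<lambda>n. \<bar>a n\<bar>)" and b: "summable (\<lambda>n. \<bar>b n\<bar>)"
  shows "(\<lambda>n. (\<Sum>i\<le>n. a i * b (n - i)) *\<^sub>R (K ^^ n) x) sums op_series a K (op_series b K x)"
proof -
  have contr1: "\<And>x. norm (K x) \<le> 1 * norm x" "(0::real) \<le> 1" using contr by auto
  have a1: "summable (\<lambda>n. \<bar>a n\<bar> * 1 ^ n)" and b1: "summable (\<lambda>n. \<bar>b n\<bar> * 1 ^ n)"
    using a b by simp_all
  note Kn = bounded_op_funpow[OF K]
  define f where "f = (\<lambda>(m, n). (a m * b n) *\<^sub>R (K ^^ (m + n)) x)"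
  have norm_f: "norm (f (m, n)) \<le> \<bar>a m\<bar> * \<bar>b n\<bar> * norm x" for m n
    using mult_left_mono[OF norm_funpow_le[OF contr1, of "m + n" x], of "\<bar>a m * b n\<bar>"]
    by (simp add: f_def abs_mult mult.assoc)
  have "(\<lambda>m. \<bar>a m\<bar>) summable_on UNIV" "(\<lambda>n. \<bar>b n\<bar>) summable_on UNIV"
    using a b by (auto intro!: norm_summable_imp_summable_on)
  then have "(\<lambda>(m, n). \<bar>a m\<bar> * \<bar>b n\<bar>) summable_on UNIV \<times> UNIV"
    by (intro summable_on_SigmaI[where g = "\<lambda>m. \<bar>a m\<bar> * (\<Sum>\<^sub>\<infinity>n. \<bar>b n\<bar>)"])
      (auto intro!: has_sum_cmult_right has_sum_infsum summable_on_cmult_left)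
  then have "(\<lambda>p. (case p of (m, n) \<Rightarrow> \<bar>a m\<bar> * \<bar>b n\<bar>) * norm x) summable_on UNIV \<times> UNIV"
    by (rule summable_on_cmult_left)
  then have "(\<lambda>p. norm (f p)) summable_on UNIV \<times> UNIV"
    by (rule summable_on_comparison_test) (auto simp: norm_f)
  then have fS: "f summable_on UNIV \<times> UNIV"
    by (rule abs_summable_summable)
  have inner: "((\<lambda>n. f (m, n)) has_sum a m *\<^sub>R (K ^^ m) (op_series b K x)) UNIV" for m
  proof (rule norm_summable_imp_has_sum)
    have eq: "f (m, n) = a m *\<^sub>R (K ^^ m) (b n *\<^sub>R (K ^^ n) x)" for n
      by (simp add: f_def bounded_op_scaleR[OF Kn] funpow_add)
    show "(\<lambda>n. f (m, n)) sums (a m *\<^sub>R (K ^^ m) (op_series b K x))"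
      unfolding eq
      by (intro sums_scaleR_right bounded_linear.sums[OF bounded_op_imp_bounded_linear[OF Kn]]
          op_series_sums[OF contr1 b1])
    show "summable (\<lambda>n. norm (f (m, n)))"
      by (rule summable_comparison_test'[where g = "\<lambda>n. \<bar>a m\<bar> * \<bar>b n\<bar> * norm x"])
        (auto simp: norm_f intro!: summable_mult2 summable_mult b)
  qed
  have outer: "((\<lambda>m. a m *\<^sub>R (K ^^ m) (op_series b K x)) has_sum
      op_series a K (op_series b K x)) UNIV"
    by (rule norm_summable_imp_has_sum)
      (use op_series_norm_summable[OF contr1 a1] op_series_sums[OF contr1 a1] in auto)
  have "(f has_sum op_series a K (op_series b K x)) (UNIV \<times> UNIV)"
    by (rule has_sum_SigmaI[OF inner outer fS])
  \<comment> \<open>Regrouping by total degree: the pair \<open>(m, n)\<close> becomes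
    \<open>(m + n, m)\<close>, which maps the square onto the triangle
    \<open>i <= n\<close>.\<close>
  also have "?this \<longleftrightarrow> ((\<lambda>(n, i). (a i * b (n - i)) *\<^sub>R (K ^^ n) x) has_sum
      op_series a K (op_series b K x)) (SIGMA n:UNIV. {..n})"
    by (rule has_sum_reindex_bij_witness[where j = "\<lambda>(m, n). (m + n, m)" and i = "\<lambda>(n, i). (i, n - i)"])
      (auto simp: f_def)
  finally have "((\<lambda>n. \<Sum>i\<le>n. (a i * b (n - i)) *\<^sub>R (K ^^ n) x) has_sum
      op_series a K (op_series b K x)) UNIV"
    by (rule has_sum_SigmaD) (auto intro!: has_sum_finiteI)
  then show ?thesis
    by (intro has_sum_imp_sums) (simp add: scaleR_sum_left)
qed

text \<open>The geometric series telescopes against its shift, and commutation of its sum with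
  \<open>K\<close> makes the left inverse two-sided.\<close>

lemma Neumann_series:
  fixes K :: "'a::chilbert \<Rightarrow> 'a"
  assumes K: "bounded_op K" and q: "\<And>x. norm (K x) \<le> q * norm x" "0 \<le> q" "q < 1"
  shows "\<exists>S. bounded_op S \<and> (\<forall>x. S (x - K x) = x) \<and> (\<forall>x. S x - K (S x) = x)"
proof -
  have sm: "summable (\<lambda>n. \<bar>1::real\<bar> * q ^ n)"
    using q by (simp add: summable_geometric)
  note q' = q(1,2) sm
  define S where "S = op_series (\<lambda>_. 1) K"
  have S: "bounded_op S"
    unfolding S_def by (rule bounded_op_op_series[OF K q'])
  have comm: "K (S x) = S (K x)" for x
    unfolding S_def by (rule op_series_intertwine[OF q' K]) simp
  have "S x - S (K x) = x" for x
  proof -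
    have 1: "(\<lambda>n. (K ^^ n) x) sums S x"
      using op_series_sums[OF q', of x] by (simp add: S_def)
    have 2: "(\<lambda>n. (K ^^ Suc n) x) sums S (K x)"
      using op_series_sums[OF q', of "K x"] by (simp add: S_def funpow_swap1)
    show ?thesis
      using sums_unique2[OF 1 sums_Suc[OF 2]] by simp
  qed
  then show ?thesis
    using S comm by (intro exI[of _ S]) (simp add: bounded_op_diff[OF S])
qed

section \<open>Square roots of positive operators\<close>

text \<open>The Taylor coefficients of \<open>sqrt (1 - t)\<close>. Since \<open>\<Sum>k\<le>n. sqrt_coeff k \<ge> 0\<close> and only
  the first coefficient is positive, the series converges absolutely up to the boundary.\<close>

definition sqrt_coeff :: "nat \<Rightarrow> real" where
  "sqrt_coeff n = (1/2 gchoose n) * (-1) ^ n"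

lemma sqrt_coeff_0 [simp]: "sqrt_coeff 0 = 1"
  by (simp add: sqrt_coeff_def)

lemma sqrt_coeff_Suc: "(real n + 1) * sqrt_coeff (Suc n) = (real n - 1/2) * sqrt_coeff n"
proof -
  have "(real n + 1) * (1/2 gchoose Suc n) = (1/2 - real n) * (1/2 gchoose n)"
    using gbinomial_mult_1[of "1/2 :: real" n] by (simp add: algebra_simps)
  then have "(real n + 1) * (1/2 gchoose Suc n) * (-1) ^ Suc n
      = (1/2 - real n) * (1/2 gchoose n) * (-1) ^ Suc n" by simp
  then show ?thesis by (simp add: sqrt_coeff_def algebra_simps)
qed

lemma sqrt_coeff_Suc_nonpos: "sqrt_coeff (Suc n) \<le> 0"
proof (induction n)
  case 0
  then show ?case using sqrt_coeff_Suc[of 0] by simp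
next
  case (Suc n)
  have "(real (Suc n) + 1) * sqrt_coeff (Suc (Suc n)) \<le> 0"
    unfolding sqrt_coeff_Suc by (rule mult_nonneg_nonpos[OF _ Suc]) simp
  then show ?case by (simp add: mult_le_0_iff)
qed

text \<open>Dividing \<open>sqrt (1 - t)\<close> by \<open>1 - t\<close> replaces coefficients by
  their partial sums; the quotient is \<open>-2\<close> times the derivative of
  \<open>sqrt (1 - t)\<close>, whence the closed form.\<close>

lemma sum_sqrt_coeff: "(\<Sum>k\<le>n. sqrt_coeff k) = - 2 * (real n + 1) * sqrt_coeff (Suc n)"
proof (induction n)
  case 0
  then show ?case using sqrt_coeff_Suc[of 0] by simp
next
  case (Suc n)
  then show ?case using sqrt_coeff_Suc[of "Suc n"] by (simp add: algebra_simps)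
qed

lemma sum_sqrt_coeff_nonneg: "0 \<le> (\<Sum>k\<le>n. sqrt_coeff k)"
  using sqrt_coeff_Suc_nonpos[of n] unfolding sum_sqrt_coeff
  by (intro mult_nonpos_nonpos) auto

lemma summable_abs_sqrt_coeff: "summable (\<lambda>n. \<bar>sqrt_coeff n\<bar>)"
proof (rule summableI_nonneg_bounded)
  fix n
  \<comment> \<open>The coefficient at 0 equals 1 and all others are nonpositive, so a single
    correction by 2 turns the negated coefficients into absolute values.\<close>
  have "\<bar>sqrt_coeff k\<bar> = (if k = 0 then 2 else 0) - sqrt_coeff k" for k
    using sqrt_coeff_Suc_nonpos[of "k - 1"] by (cases k) auto
  then have "(\<Sum>k\<le>n. \<bar>sqrt_coeff k\<bar>) = 2 - (\<Sum>k\<le>n. sqrt_coeff k)"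
    by (simp add: sum_subtractf)
  moreover have "(\<Sum>k<n. \<bar>sqrt_coeff k\<bar>) \<le> (\<Sum>k\<le>n. \<bar>sqrt_coeff k\<bar>)"
    by (rule sum_mono2) auto
  ultimately show "(\<Sum>k<n. \<bar>sqrt_coeff k\<bar>) \<le> 2"
    using sum_sqrt_coeff_nonneg[of n] by simp
qed simp

text \<open>Coefficientwise, the square of \<open>sqrt (1 - t)\<close> is \<open>1 - t\<close>:
  Vandermonde's identity with \<open>1/2 + 1/2 = 1\<close>.\<close>

lemma sqrt_coeff_convolution:
  "(\<Sum>i\<le>n. sqrt_coeff i * sqrt_coeff (n - i)) = (if n = 0 then 1 else if n = 1 then -1 else 0)"
proof -
  have "(\<Sum>i\<le>n. sqrt_coeff i * sqrt_coeff (n - i))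
      = (\<Sum>i\<le>n. (1/2 gchoose i) * (1/2 gchoose (n - i))) * (-1) ^ n"
    unfolding sum_distrib_right sqrt_coeff_def
    by (intro sum.cong refl) (simp add: power_add[symmetric] mult.assoc mult.left_commute)
  also have "(\<Sum>i\<le>n. (1/2 gchoose i) * (1/2 gchoose (n - i))) = (1 :: real) gchoose n"
    using gbinomial_Vandermonde[of "1/2 :: real" "1/2" n] by (simp add: atMost_atLeast0)
  also have "\<dots> = of_nat (1 choose n)"
    using binomial_gbinomial[of 1 n, where 'a = real] by simp
  finally show ?thesis
    by (auto simp: binomial_eq_0)
qed

lemma op_series_sqrt_sqrt:
  assumes K: "bounded_op K" and contr: "\<And>x. norm (K x) \<le> norm x"
  shows "op_series sqrt_coeff K (op_series sqrt_coeff K x) = x - K x"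
proof -
  have "(\<lambda>n. (if n = 0 then 1 else if n = 1 then -1 else 0) *\<^sub>R (K ^^ n) x) sums
      op_series sqrt_coeff K (op_series sqrt_coeff K x)"
    using op_series_Cauchy_product[OF K contr summable_abs_sqrt_coeff summable_abs_sqrt_coeff]
    by (simp add: sqrt_coeff_convolution)
  moreover have "(\<lambda>n. (if n = 0 then 1 else if n = 1 then -1 else 0) *\<^sub>R (K ^^ n) x) sums
      (\<Sum>n\<in>{0, 1}. (if n = 0 then 1 else if n = 1 then -1 else 0) *\<^sub>R (K ^^ n) x)"
    by (rule sums_finite) auto
  ultimately show ?thesis
    by (auto dest: sums_unique2)
qed

text \<open>Each \<open>\<langle>K^k x, x\<rangle>\<close> is real and at most
  \<open>(norm x)\<^sup>2\<close>. Multiplying by the nonpositive coefficients with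
  \<open>k > 0\<close> reverses this bound, and \<open>k = 0\<close> gives equality, so every
  partial sum of the form dominates a nonnegative partial coefficient sum times
  \<open>(norm x)\<^sup>2\<close>.\<close>

lemma positive_op_op_series_sqrt:
  assumes K: "positive_op K" and contr: "\<And>x. norm (K x) \<le> norm x"
  shows "positive_op (op_series sqrt_coeff K)"
proof (rule positive_opI)
  have contr1: "\<And>x. norm (K x) \<le> 1 * norm x" "(0::real) \<le> 1"
    and c1: "summable (\<lambda>n. \<bar>sqrt_coeff n\<bar> * 1 ^ n)"
    using contr summable_abs_sqrt_coeff by auto
  show "bounded_op (op_series sqrt_coeff K)"
    by (rule bounded_op_op_series[OF positive_opD(1)[OF K] contr1 c1])
  fix x
  have sym: "cinner ((K ^^ n) u) v = cinner u ((K ^^ n) v)" for n u v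
    by (induction n arbitrary: u v) (simp_all add: positive_op_symmetric[OF K] funpow_swap1)
  have im: "Im (cinner ((K ^^ n) x) x) = 0" for n
    using sym[of n x x] cinner_commute[of x "(K ^^ n) x"] by (simp add: complex_eq_iff)
  have re: "Re (cinner ((K ^^ n) x) x) \<le> (norm x)\<^sup>2" for n
    using form_le_norm[of "K ^^ n" 1 x] norm_funpow_le[OF contr1, of n] by simp
  have "(\<lambda>n. \<Sum>k<n. sqrt_coeff k *\<^sub>R (K ^^ k) x) \<longlonglongrightarrow> op_series sqrt_coeff K x"
    using op_series_sums[OF contr1 c1, of x] by (simp add: sums_def)
  from tendsto_cinner_left[OF LIMSEQ_Suc[OF this], of x]
  have lim: "(\<lambda>n. \<Sum>k\<le>n. of_real (sqrt_coeff k) * cinner ((K ^^ k) x) x) \<longlonglongrightarrow>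
      cinner (op_series sqrt_coeff K x) x"
    by (simp add: cinner_sum_left cinner_scaleR_left lessThan_Suc_atMost)
  have "(\<lambda>n. 0) \<longlonglongrightarrow> Im (cinner (op_series sqrt_coeff K x) x)"
    using tendsto_Im[OF lim] by (simp add: im)
  then show "Im (cinner (op_series sqrt_coeff K x) x) = 0"
    by (simp add: LIMSEQ_const_iff)
  have "0 \<le> (\<Sum>k\<le>n. sqrt_coeff k * Re (cinner ((K ^^ k) x) x))" for n
  proof -
    have "0 \<le> (\<Sum>k\<le>n. sqrt_coeff k) * (norm x)\<^sup>2"
      by (simp add: sum_sqrt_coeff_nonneg)
    also have "\<dots> \<le> (\<Sum>k\<le>n. sqrt_coeff k * Re (cinner ((K ^^ k) x) x))"
      unfolding sum_distrib_right
    proof (rule sum_mono)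
      fix k
      show "sqrt_coeff k * (norm x)\<^sup>2 \<le> sqrt_coeff k * Re (cinner ((K ^^ k) x) x)"
        using mult_left_mono_neg[OF re[of k] sqrt_coeff_Suc_nonpos[of "k - 1"]]
        by (cases k) (auto simp: Re_cinner_self)
    qed
    finally show ?thesis .
  qed
  then show "0 \<le> Re (cinner (op_series sqrt_coeff K x) x)"
    using tendsto_Re[OF lim] by (intro LIMSEQ_le_const) auto
qed

text \<open>If \<open>M\<close> bounds the norm of a positive \<open>A\<close>, then
  \<open>A = M (I - K)\<close> with \<open>K = I - A / M\<close> a positive contraction; the root is
  therefore \<open>sqrt M\<close> times the binomial series in \<open>K\<close>.\<close>

definition sqrt_series :: "real \<Rightarrow> ('a::chilbert \<Rightarrow> 'a) \<Rightarrow> 'a \<Rightarrow> 'a" where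
  "sqrt_series M A x = sqrt M *\<^sub>R op_series sqrt_coeff (\<lambda>x. x - (1 / M) *\<^sub>R A x) x"

text \<open>The two halves of \<open>0 <= A <= M I\<close> exchange roles: the upper bound makes the
  complement positive, and positivity of \<open>A\<close> makes it a contraction.\<close>

lemma positive_op_complement:
  assumes A: "positive_op A" and M: "\<And>x. norm (A x) \<le> M * norm x" "0 < M"
  shows "positive_op (\<lambda>x. x - (1 / M) *\<^sub>R A x)" "norm (x - (1 / M) *\<^sub>R A x) \<le> norm x"
proof -
  note bA = positive_opD(1)[OF A]
  show pos: "positive_op (\<lambda>x. x - (1 / M) *\<^sub>R A x)"
  proof (rule positive_opI)
    show "bounded_op (\<lambda>x. x - (1 / M) *\<^sub>R A x)"
      by (intro bounded_op_diff_op bounded_op_id bounded_op_scaleR_op bA)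
    show "0 \<le> Re (cinner (x - (1 / M) *\<^sub>R A x) x)" for x
      using form_le_norm[of A M x] M by (simp add: cinner_simps Re_cinner_self field_simps)
    show "Im (cinner (x - (1 / M) *\<^sub>R A x) x) = 0" for x
      using positive_opD(3)[OF A, of x] by (simp add: cinner_simps cinner_self)
  qed
  have "norm (x - (1 / M) *\<^sub>R A x) \<le> 1 * norm x"
  proof (rule positive_op_norm_le[OF pos])
    show "Re (cinner (x - (1 / M) *\<^sub>R A x) x) \<le> 1 * (norm x)\<^sup>2" for x
      using positive_opD(2)[OF A, of x] M(2) by (simp add: cinner_simps Re_cinner_self)
  qed simp
  then show "norm (x - (1 / M) *\<^sub>R A x) \<le> norm x" by simp
qed

lemma positive_op_sqrt_series:
  assumes A: "positive_op A" and M: "\<And>x. norm (A x) \<le> M * norm x" "0 < M"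
  shows "positive_op (sqrt_series M A)" "sqrt_series M A (sqrt_series M A x) = A x"
proof -
  let ?K = "\<lambda>x. x - (1 / M) *\<^sub>R A x"
  note K = positive_op_complement[OF A M]
  have S: "positive_op (op_series sqrt_coeff ?K)"
    by (rule positive_op_op_series_sqrt[OF K])
  show "positive_op (sqrt_series M A)"
  proof (rule positive_opI)
    show "bounded_op (sqrt_series M A)"
      using bounded_op_scaleR_op[OF positive_opD(1)[OF S], of "sqrt M"]
      by (simp add: sqrt_series_def[abs_def])
    show "0 \<le> Re (cinner (sqrt_series M A x) x)" for x
      using positive_opD(2)[OF S, of x] M(2) by (simp add: sqrt_series_def cinner_simps)
    show "Im (cinner (sqrt_series M A x) x) = 0" for x
      using positive_opD(3)[OF S, of x] by (simp add: sqrt_series_def cinner_simps)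
  qed
  have "sqrt_series M A (sqrt_series M A x)
      = (sqrt M * sqrt M) *\<^sub>R op_series sqrt_coeff ?K (op_series sqrt_coeff ?K x)"
    unfolding sqrt_series_def by (simp add: bounded_op_scaleR[OF positive_opD(1)[OF S]])
  also have "\<dots> = M *\<^sub>R ((1 / M) *\<^sub>R A x)"
    using M(2) op_series_sqrt_sqrt[OF positive_opD(1)[OF K(1)] K(2), of x] by simp
  finally show "sqrt_series M A (sqrt_series M A x) = A x"
    using M(2) by simp
qed

lemma sqrt_series_intertwine:
  assumes A: "positive_op A" and M: "\<And>x. norm (A x) \<le> M * norm x" "0 < M"
    and B: "bounded_op B" and comm: "\<And>x. B (A x) = A' (B x)"
  shows "B (sqrt_series M A x) = sqrt_series M A' (B x)"
proof -
  have "B (op_series sqrt_coeff (\<lambda>x. x - (1 / M) *\<^sub>R A x) x)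
      = op_series sqrt_coeff (\<lambda>x. x - (1 / M) *\<^sub>R A' x) (B x)"
    by (rule op_series_intertwine[where q = 1])
      (use positive_op_complement[OF A M] summable_abs_sqrt_coeff B in
        \<open>auto simp: bounded_op_diff[OF B] bounded_op_scaleR[OF B] comm\<close>)
  then show ?thesis
    by (simp add: sqrt_series_def bounded_op_scaleR[OF B])
qed

lemma positive_op_form_zero:
  assumes "positive_op S" "Re (cinner (S x) x) = 0"
  shows "S x = 0"
  using positive_op_norm_sq_le[OF assms(1) form_le_norm[OF bounded_op_norm[OF positive_opD(1)[OF assms(1)]]], of x]
    assms(2) by simp

text \<open>By commutation \<open>S + T\<close> annihilates \<open>y = S x - T x\<close>. Both forms
  are nonnegative, so each vanishes at \<open>y\<close>, whence \<open>S y = T y = 0\<close>; moving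
  \<open>S\<close> and \<open>T\<close> across the inner product gives
  \<open>\<langle>y, y\<rangle> = 0\<close>.\<close>

lemma positive_sqrt_unique_of_commute:
  assumes S: "positive_op S" and T: "positive_op T"
    and sq: "\<And>x. S (S x) = T (T x)" and comm: "\<And>x. S (T x) = T (S x)"
  shows "S x = T x"
proof -
  note bS = positive_opD(1)[OF S] and bT = positive_opD(1)[OF T]
  define y where "y = S x - T x"
  have "S y + T y = 0"
    by (simp add: y_def bounded_op_diff[OF bS] bounded_op_diff[OF bT] sq comm)
  then have "Re (cinner (S y) y) + Re (cinner (T y) y) = 0"
    by (metis cinner_add_left cinner_zero_left plus_complex.sel(1) zero_complex.sel(1))
  then have "Re (cinner (S y) y) = 0" "Re (cinner (T y) y) = 0"
    using positive_opD(2)[OF S, of y] positive_opD(2)[OF T, of y] by linarith+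
  then have "S y = 0" "T y = 0"
    using positive_op_form_zero S T by blast+
  then have "cinner y y = 0"
    by (metis cinner_diff_right cinner_zero_left positive_op_symmetric[OF S]
        positive_op_symmetric[OF T] y_def)
  then show ?thesis
    by (simp add: cinner_self y_def)
qed

lemma op_sqrt_eq_sqrt_series:
  assumes A: "positive_op A" and M: "\<And>x. norm (A x) \<le> M * norm x" "0 < M"
  shows "op_sqrt A = sqrt_series M A"
  unfolding op_sqrt_def
proof (rule the_equality)
  note S = positive_op_sqrt_series[OF A M]
  show "positive_op (sqrt_series M A) \<and> sqrt_series M A \<circ> sqrt_series M A = A"
    using S by (auto simp: fun_eq_iff)
  fix T assume T: "positive_op T \<and> T \<circ> T = A"
  then have TT: "T (T x) = A x" for x by (metis comp_apply)
  have pT: "positive_op T" using T by blast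
  \<comment> \<open>Any root \<open>T\<close> commutes with \<open>A = T T\<close>, hence with the
    series in \<open>A\<close>; this supplies the commutation demanded by uniqueness.\<close>
  have comm: "T (sqrt_series M A x) = sqrt_series M A (T x)" for x
    by (rule sqrt_series_intertwine[OF A M positive_opD(1)[OF pT]]) (metis TT)
  show "T = sqrt_series M A"
    using positive_sqrt_unique_of_commute[where S = T and T = "sqrt_series M A", OF pT S(1) _ comm]
    by (simp add: TT S(2) ext)
qed

lemma positive_op_op_sqrt: "positive_op A \<Longrightarrow> positive_op (op_sqrt A)"
  and op_sqrt_op_sqrt: "positive_op A \<Longrightarrow> op_sqrt A (op_sqrt A x) = A x"
proof -
  assume A: "positive_op A"
  note bA = positive_opD(1)[OF A]
  \<comment> \<open>The summand 1 keeps the scaling constant positive even for the zero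
    operator.\<close>
  have "norm (A x) \<le> (onorm A + 1) * norm x" for x
    by (rule order_trans[OF bounded_op_norm[OF bA] mult_right_mono]) auto
  moreover have "0 < onorm A + 1"
    using bounded_op_onorm_nonneg[OF bA] by simp
  ultimately show "positive_op (op_sqrt A)" "op_sqrt A (op_sqrt A x) = A x"
    using positive_op_sqrt_series[OF A] op_sqrt_eq_sqrt_series[OF A] by metis+
qed

lemma op_sqrt_intertwine:
  assumes P: "positive_op P" and Q: "positive_op Q" and B: "bounded_op B"
    and comm: "\<And>x. B (P x) = Q (B x)"
  shows "B (op_sqrt P x) = op_sqrt Q (B x)"
proof -
  note bP = positive_opD(1)[OF P] and bQ = positive_opD(1)[OF Q]
  \<comment> \<open>A common scaling constant presents both roots as the same series, so that they
    can be intertwined.\<close>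
  define M where "M = onorm P + onorm Q + 1"
  have M: "0 < M"
    using bounded_op_onorm_nonneg[OF bP] bounded_op_onorm_nonneg[OF bQ] by (simp add: M_def)
  have PM: "norm (P x) \<le> M * norm x" for x
    by (rule order_trans[OF bounded_op_norm[OF bP] mult_right_mono])
      (use bounded_op_onorm_nonneg[OF bQ] in \<open>auto simp: M_def\<close>)
  have QM: "norm (Q y) \<le> M * norm y" for y
    by (rule order_trans[OF bounded_op_norm[OF bQ] mult_right_mono])
      (use bounded_op_onorm_nonneg[OF bP] in \<open>auto simp: M_def\<close>)
  show ?thesis
    unfolding op_sqrt_eq_sqrt_series[OF P PM M] op_sqrt_eq_sqrt_series[OF Q QM M]
    using sqrt_series_intertwine[where A = P and A' = Q and B = B, OF P PM M B comm] .
qed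

lemma norm_op_sqrt_sq:
  assumes "positive_op A"
  shows "(norm (op_sqrt A x))\<^sup>2 = Re (cinner (A x) x)"
proof -
  have "cinner (op_sqrt A x) (op_sqrt A x) = cinner (op_sqrt A (op_sqrt A x)) x"
    by (rule positive_op_symmetric[OF positive_op_op_sqrt[OF assms], symmetric])
  then show ?thesis
    by (simp only: op_sqrt_op_sqrt[OF assms] flip: Re_cinner_self)
qed

section \<open>The mixed Schwarz inequality\<close>

text \<open>Divided by \<open>M + e\<close>, the operator \<open>D + e I\<close> is
  \<open>I - K\<close> with \<open>norm K <= M / (M + e) < 1\<close>, so the Neumann series inverts
  it. This yields approximations \<open>D v\<close> of an arbitrary \<open>x\<close> inside the
  range of \<open>D\<close>.\<close>

lemma positive_op_shift_surj:
  assumes D: "positive_op D" and e: "0 < e"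
  shows "\<exists>v. x = D v + e *\<^sub>R v"
proof -
  note bD = positive_opD(1)[OF D]
  define M where "M = onorm D + 1"
  have M: "0 < M"
    using bounded_op_onorm_nonneg[OF bD] by (simp add: M_def)
  have DM: "norm (D x) \<le> M * norm x" for x
    by (rule order_trans[OF bounded_op_norm[OF bD] mult_right_mono]) (auto simp: M_def)
  define K where "K x = (M / (M + e)) *\<^sub>R (x - (1 / M) *\<^sub>R D x)" for x
  have K: "bounded_op K"
    unfolding K_def[abs_def]
    by (rule bounded_op_scaleR_op[OF positive_opD(1)[OF positive_op_complement(1)[OF D DM M]]])
  have Kn: "norm (K x) \<le> (M / (M + e)) * norm x" for x
    using mult_left_mono[OF positive_op_complement(2)[OF D DM M, of x], of "M / (M + e)"] M e
    by (simp add: K_def)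
  obtain S where "\<And>x. S x - K (S x) = x"
    using Neumann_series[OF K Kn] M e by auto
  then have "S x - K (S x) = x" .
  then have "x = (1 / (M + e)) *\<^sub>R ((M + e) *\<^sub>R (S x - K (S x)))"
    using M e by simp
  moreover have "(M + e) *\<^sub>R K (S x) = M *\<^sub>R S x - D (S x)"
    using M e by (simp add: K_def scaleR_diff_right)
  then have "(M + e) *\<^sub>R (S x - K (S x)) = D (S x) + e *\<^sub>R S x"
    by (simp add: scaleR_diff_right scaleR_add_left)
  ultimately have "x = (1 / (M + e)) *\<^sub>R (D (S x) + e *\<^sub>R S x)"
    by simp
  then show ?thesis
    by (intro exI[of _ "(1 / (M + e)) *\<^sub>R S x"])
      (simp only: bounded_op_scaleR[OF bD] scaleR_add_right scaleR_scaleR mult.commute)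
qed

section \<open>Absolute values of an operator and of its adjoint\<close>

lemma norm_op_abs:
  assumes B: "bounded_op B"
  shows "norm (op_abs B x) = norm (B x)"
proof -
  have "(norm (op_abs B x))\<^sup>2 = (norm (B x))\<^sup>2"
    unfolding op_abs_def norm_op_sqrt_sq[OF positive_op_adjoint_comp(1)[OF B]]
    by (simp add: cinner_adjoint'[OF B] Re_cinner_self)
  then show ?thesis by simp
qed

lemma norm_op_abs_adj:
  assumes B: "bounded_op B"
  shows "norm (op_abs_adj B x) = norm (adjoint B x)"
proof -
  have "(norm (op_abs_adj B x))\<^sup>2 = (norm (adjoint B x))\<^sup>2"
    unfolding op_abs_adj_def norm_op_sqrt_sq[OF positive_op_adjoint_comp(2)[OF B]]
    by (simp add: cinner_adjoint[OF B] Re_cinner_self)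
  then show ?thesis by simp
qed

lemma positive_op_op_abs: "bounded_op B \<Longrightarrow> positive_op (op_abs B)"
  and positive_op_op_abs_adj: "bounded_op B \<Longrightarrow> positive_op (op_abs_adj B)"
  by (simp_all add: op_abs_def op_abs_adj_def positive_op_op_sqrt positive_op_adjoint_comp)

text \<open>Write \<open>E\<close> and \<open>E'\<close> for the square roots of \<open>op_abs B\<close> and \<open>op_abs_adj B\<close>. Since \<open>B E = E' B\<close>,
  a vector \<open>E u\<close> satisfies \<open>\<langle>B E u, y\<rangle> = \<langle>B u, E' y\<rangle>\<close> with \<open>norm (B u) = norm (E E u)\<close>, and every
  vector is approximated by such vectors up to vectors on which \<open>B\<close> is small.\<close>

lemma mixed_Schwarz:
  fixes B :: "'a::chilbert \<Rightarrow> 'a"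
  assumes B: "bounded_op B"
  shows "cmod (cinner (B x) y)
    \<le> sqrt (Re (cinner (op_abs B x) x)) * sqrt (Re (cinner (op_abs_adj B y) y))"
proof -
  define D D' where "D = op_abs B" and "D' = op_abs_adj B"
  define E E' where "E = op_sqrt D" and "E' = op_sqrt D'"
  have D: "positive_op D" and D': "positive_op D'"
    by (simp_all add: D_def D'_def positive_op_op_abs positive_op_op_abs_adj B)
  have E: "positive_op E" and E': "positive_op E'"
    by (simp_all add: E_def E'_def positive_op_op_sqrt D D')
  note bD = positive_opD(1)[OF D] and bE = positive_opD(1)[OF E]
  have EE: "E (E x) = D x" for x
    unfolding E_def by (rule op_sqrt_op_sqrt[OF D])
  have nE: "norm (E x) = sqrt (Re (cinner (D x) x))" for x
    by (simp add: E_def flip: norm_op_sqrt_sq[OF D])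
  have nE': "norm (E' y) = sqrt (Re (cinner (D' y) y))" for y
    by (simp add: E'_def flip: norm_op_sqrt_sq[OF D'])
  have BD: "B (D x) = D' (B x)" for x
    unfolding D_def D'_def op_abs_def op_abs_adj_def
    by (rule op_sqrt_intertwine[OF positive_op_adjoint_comp[OF B] B]) simp
  have BE: "B (E x) = E' (B x)" for x
    unfolding E_def E'_def
    using op_sqrt_intertwine[where P = D and Q = D' and B = B, OF D D' B BD] .
  have range: "cmod (cinner (B (E u)) y) \<le> norm (E (E u)) * norm (E' y)" for u
    using cinner_Cauchy_Schwarz[of "B u" "E' y"] norm_op_abs[OF B, of u]
    by (simp add: BE positive_op_symmetric[OF E'] EE D_def)
  have approx: "cmod (cinner (B x) y) \<le> norm (E x) * norm (E' y) + e * (norm x * norm y)"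
    if e: "0 < e" for e
  proof -
    obtain v where v: "x = D v + e *\<^sub>R v"
      using positive_op_shift_surj[OF D e] by blast
    \<comment> \<open>The cross term in the expansion of \<open>D v + e v\<close> is nonnegative.
      The resulting bound also controls \<open>B v\<close>, whose norm is that of
      \<open>D v\<close>, uniformly in \<open>e\<close>.\<close>
    have Dv: "norm (D v) \<le> norm x"
    proof (rule power2_le_imp_le)
      have "(norm x)\<^sup>2 = (norm (D v))\<^sup>2 + 2 * e * Re (cinner (D v) v) + e\<^sup>2 * (norm v)\<^sup>2"
        unfolding v norm_add_sq using e by (simp add: cinner_simps power_mult_distrib)
      then show "(norm (D v))\<^sup>2 \<le> (norm x)\<^sup>2"
        using e positive_opD(2)[OF D, of v] by simp
    qed simp
    have EDv: "norm (E (D v)) \<le> norm (E x)"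
    proof (rule power2_le_imp_le)
      have "Re (cinner (E (D v)) (E v)) = (norm (D v))\<^sup>2"
        by (simp add: positive_op_symmetric[OF E] EE Re_cinner_self)
      then have "(norm (E x))\<^sup>2 = (norm (E (D v)))\<^sup>2 + 2 * e * (norm (D v))\<^sup>2 + e\<^sup>2 * (norm (E v))\<^sup>2"
        unfolding v bounded_op_add[OF bE] bounded_op_scaleR[OF bE] norm_add_sq
        using e by (simp add: cinner_simps power_mult_distrib)
      then show "(norm (E (D v)))\<^sup>2 \<le> (norm (E x))\<^sup>2"
        using e by simp
    qed simp
    have "cmod (cinner (B (D v)) y) \<le> norm (E x) * norm (E' y)"
      using range[of "E v"] mult_right_mono[OF EDv norm_ge_zero[of "E' y"]] by (simp add: EE)
    moreover have "cmod (cinner (B v) y) \<le> norm x * norm y"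
      using cinner_Cauchy_Schwarz[of "B v" y] mult_right_mono[OF Dv norm_ge_zero[of y]]
        norm_op_abs[OF B, of v] by (simp add: D_def)
    then have "e * cmod (cinner (B v) y) \<le> e * (norm x * norm y)"
      using e by (intro mult_left_mono) auto
    moreover have "cmod (cinner (B x) y)
        \<le> cmod (cinner (B (D v)) y) + e * cmod (cinner (B v) y)"
      using norm_triangle_ineq[of "cinner (B (D v)) y" "e * cinner (B v) y"] e
      by (simp add: v bounded_op_add[OF B] bounded_op_scaleR[OF B] cinner_simps norm_mult)
    ultimately show ?thesis by linarith
  qed
  have "cmod (cinner (B x) y) \<le> norm (E x) * norm (E' y)"
  proof (rule field_le_epsilon)
    fix e :: real assume "0 < e"
    \<comment> \<open>The added 1 avoids division by zero when \<open>x\<close> or \<open>y\<close>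
      vanishes.\<close>
    let ?d = "e / (norm x * norm y + 1)"
    have "0 < norm x * norm y + 1"
      by (simp add: add_nonneg_pos)
    then have "0 < ?d" "?d * (norm x * norm y) \<le> e"
      using \<open>0 < e\<close> by (simp_all add: field_simps)
    then show "cmod (cinner (B x) y) \<le> norm (E x) * norm (E' y) + e"
      using approx[of ?d] by linarith
  qed
  then show ?thesis
    unfolding nE nE' D_def D'_def .
qed

section \<open>Spectral radius\<close>

text \<open>Beyond the norm, \<open>T - l I = -l (I - T / l)\<close> is inverted by a Neumann
  series. This bounds the set whose supremum defines the spectral radius.\<close>

lemma cmod_spectrum_le_onorm:
  assumes T: "bounded_op T" and l: "l \<in> op_spectrum T"
  shows "cmod l \<le> onorm T"
proof (rule ccontr)
  assume "\<not> cmod l \<le> onorm T"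
  then have lt: "onorm T < cmod l" by simp
  then have l0: "l \<noteq> 0"
    using bounded_op_onorm_nonneg[OF T] by auto
  define K where "K x = scaleC (1 / l) (T x)" for x
  have K: "bounded_op K"
    unfolding K_def[abs_def] by (rule bounded_op_scaleC_op[OF T])
  have Kn: "norm (K x) \<le> (onorm T / cmod l) * norm x" for x
    using bounded_op_norm[OF T, of x] l0 by (simp add: K_def norm_scaleC norm_divide field_simps)
  have "0 \<le> onorm T / cmod l" "onorm T / cmod l < 1"
    using lt l0 bounded_op_onorm_nonneg[OF T] by auto
  then obtain S where S: "bounded_op S" "\<And>x. S (x - K x) = x" "\<And>x. S x - K (S x) = x"
    using Neumann_series[OF K Kn] by blast
  have lK: "T x - scaleC l x = scaleC (- l) (x - K x)" for x
  proof -
    have "scaleC (- l) x = - scaleC l x"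
      using scaleC_add_left[of l "- l" x] scaleC_of_real[of 0 x] by (simp add: eq_neg_iff_add_eq_0 add.commute)
    moreover have "scaleC (- l) (K x) = - T x"
      using l0 scaleC_of_real[of "-1" "T x"] by (simp add: K_def scaleC_scaleC)
    ultimately show ?thesis by (simp add: scaleC_diff_right)
  qed
  let ?R = "\<lambda>x. scaleC (- 1 / l) (S x)"
  have "bounded_op ?R"
    by (rule bounded_op_scaleC_op[OF S(1)])
  moreover have "?R (T x - scaleC l x) = x" for x
    using l0 by (simp add: lK bounded_op_scaleC[OF S(1)] S(2) scaleC_scaleC scaleC_one)
  moreover have "T (?R x) - scaleC l (?R x) = x" for x
    using l0 by (simp only: lK bounded_op_scaleC[OF K] scaleC_diff_right[symmetric] S(3))
      (simp add: scaleC_scaleC scaleC_one)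
  ultimately show False
    using l unfolding op_spectrum_def by blast
qed

lemma bdd_above_spectrum:
  assumes T: "bounded_op T"
  shows "bdd_above (insert 0 (cmod ` op_spectrum T))"
  using cmod_spectrum_le_onorm[OF T] bounded_op_onorm_nonneg[OF T]
  by (intro bdd_aboveI[of _ "onorm T"]) auto

lemma cmod_spectrum_le_spectral_radius:
  assumes T: "bounded_op T" and l: "l \<in> op_spectrum T"
  shows "cmod l \<le> spectral_radius T"
  unfolding spectral_radius_def
  by (rule cSup_upper[OF _ bdd_above_spectrum[OF T]]) (use l in simp)

lemma spectral_radius_nonneg:
  assumes T: "bounded_op T"
  shows "0 \<le> spectral_radius T"
  unfolding spectral_radius_def
  by (rule cSup_upper[OF _ bdd_above_spectrum[OF T]]) simp

text \<open>Jacobson's resolvent identity: if \<open>S\<close> inverts \<open>Y X - l\<close>, then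
  \<open>(X S Y - I) / l\<close> inverts \<open>X Y - l\<close>.\<close>

lemma op_spectrum_comp_commute:
  assumes X: "bounded_op X" and Y: "bounded_op Y" and l0: "l \<noteq> 0"
    and l: "l \<in> op_spectrum (X \<circ> Y)"
  shows "l \<in> op_spectrum (Y \<circ> X)"
proof (rule ccontr)
  assume "l \<notin> op_spectrum (Y \<circ> X)"
  then obtain S where S: "bounded_op S" "\<And>x. S (Y (X x) - scaleC l x) = x"
      "\<And>x. Y (X (S x)) - scaleC l (S x) = x"
    unfolding op_spectrum_def by auto
  let ?R = "\<lambda>x. scaleC (1 / l) (X (S (Y x)) - x)"
  have "bounded_op ?R"
    using bounded_op_scaleC_op[OF bounded_op_diff_op[OF bounded_op_comp[OF X bounded_op_comp[OF S(1) Y]] bounded_op_id]]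
    by simp
  moreover have "?R ((X \<circ> Y) x - scaleC l x) = x" for x
  proof -
    have "S (Y ((X \<circ> Y) x - scaleC l x)) = Y x"
      using S(2)[of "Y x"] by (simp add: bounded_op_diff[OF Y] bounded_op_scaleC[OF Y])
    then show ?thesis using l0 by (simp add: scaleC_scaleC scaleC_one)
  qed
  moreover have "(X \<circ> Y) (?R x) - scaleC l (?R x) = x" for x
  proof -
    have "X (Y (X (S (Y x)))) = X (Y x) + scaleC l (X (S (Y x)))"
      using arg_cong[OF S(3)[of "Y x"], of X]
      by (simp add: bounded_op_diff[OF X] bounded_op_scaleC[OF X] algebra_simps)
    then have "(X \<circ> Y) (X (S (Y x)) - x) = scaleC l (X (S (Y x)))"
      by (simp add: bounded_op_diff[OF X] bounded_op_diff[OF Y])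
    then show ?thesis
      using l0 bounded_op_scaleC[OF bounded_op_comp[OF X Y], of "1 / l"]
      by (simp add: scaleC_scaleC scaleC_one del: comp_apply)
  qed
  ultimately show False
    using l unfolding op_spectrum_def by blast
qed

text \<open>A maximising sequence for \<open>norm (R x)\<close> consists of approximate eigenvectors, so a bounded
  inverse of \<open>R - onorm R\<close> would force the norm of \<open>R\<close> below \<open>onorm R\<close>.\<close>

lemma onorm_in_spectrum:
  assumes R: "positive_op R" and pos: "0 < onorm R"
  shows "complex_of_real (onorm R) \<in> op_spectrum R"
proof (rule ccontr)
  note bR = positive_opD(1)[OF R]
  define M where "M = onorm R"
  assume "\<not> ?thesis"
  then obtain S where S: "bounded_op S" "\<And>x. S (R x - M *\<^sub>R x) = x"
    unfolding op_spectrum_def M_def by (auto simp: scaleC_of_real)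
  \<comment> \<open>Adding \<open>1 / M\<close> makes \<open>k\<close> positive and ensures
    \<open>1 / k <= M\<close>, so the radicand \<open>M\<^sup>2 - 1 / k\<^sup>2\<close> below is
    nonnegative.\<close>
  define k where "k = onorm S + 1 / M"
  have M: "0 < M" using pos by (simp add: M_def)
  have k: "1 / M \<le> k" "0 < k"
    using bounded_op_onorm_nonneg[OF S(1)] M by (auto simp: k_def add_nonneg_pos)
  have bound: "norm (R x) \<le> sqrt (M\<^sup>2 - 1 / k\<^sup>2) * norm x" for x
  proof -
    have "norm x \<le> onorm S * norm (R x - M *\<^sub>R x)"
      using bounded_op_norm[OF S(1), of "R x - M *\<^sub>R x"] by (simp add: S(2))
    also have "\<dots> \<le> k * norm (R x - M *\<^sub>R x)"
      by (rule mult_right_mono) (use M in \<open>auto simp: k_def\<close>)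
    finally have "(norm x)\<^sup>2 \<le> k\<^sup>2 * (norm (R x - M *\<^sub>R x))\<^sup>2"
      by (metis norm_ge_zero power_mono power_mult_distrib)
    then have 1: "(norm x)\<^sup>2 / k\<^sup>2 \<le> (norm (R x - M *\<^sub>R x))\<^sup>2"
      using k by (simp add: field_simps)
    have 2: "(norm (R x))\<^sup>2 \<le> M * Re (cinner (R x) x)"
      unfolding M_def by (rule positive_op_norm_sq_le[OF R form_le_norm[OF bounded_op_norm[OF bR]]])
    \<comment> \<open>Expanding the square in the first bound produces \<open>-2 M\<close> times the
      form, and the second bound replaces this by at most \<open>-2\<close> times
      \<open>(norm (R x))\<^sup>2\<close>.\<close>
    have "(norm (R x))\<^sup>2 \<le> (M\<^sup>2 - 1 / k\<^sup>2) * (norm x)\<^sup>2"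
      using 1 2 by (simp add: norm_diff_sq cinner_simps algebra_simps)
    then show ?thesis
      using real_sqrt_le_mono by (fastforce simp: real_sqrt_mult)
  qed
  have "onorm R \<le> sqrt (M\<^sup>2 - 1 / k\<^sup>2)"
  proof (rule onorm_bound[OF _ bound])
    have "(1 / k)\<^sup>2 \<le> M\<^sup>2"
      using k M by (intro power_mono) (auto simp: field_simps)
    then show "0 \<le> sqrt (M\<^sup>2 - 1 / k\<^sup>2)"
      by (simp add: power_divide)
  qed
  moreover have "sqrt (M\<^sup>2 - 1 / k\<^sup>2) < sqrt (M\<^sup>2)"
    using k by (intro real_sqrt_less_mono) simp
  ultimately show False
    using M by (simp add: M_def)
qed

section \<open>Products and sums of two positive operators\<close>

lemma norm_op_sqrt_comp_le:
  assumes P: "positive_op P" and Q: "positive_op Q"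
  shows "norm (op_sqrt P (op_sqrt Q x)) \<le> sqrt (spectral_radius (P \<circ> Q)) * norm x"
proof -
  define b where "b = op_sqrt Q"
  have b: "positive_op b"
    unfolding b_def by (rule positive_op_op_sqrt[OF Q])
  note bP = positive_opD(1)[OF P] and bb = positive_opD(1)[OF b] and bQ = positive_opD(1)[OF Q]
  have bbQ: "b \<circ> b = Q"
    using op_sqrt_op_sqrt[OF Q] by (auto simp: b_def)
  define R where "R = b \<circ> (P \<circ> b)"
  have form: "cinner (R x) x = cinner (P (b x)) (b x)" for x
    by (simp add: R_def positive_op_symmetric[OF b])
  have bR: "bounded_op R"
    unfolding R_def by (intro bounded_op_comp bP bb)
  have R: "positive_op R"
    by (rule positive_opI[OF bR]) (simp_all add: form positive_opD[OF P])
  have "onorm R \<le> spectral_radius (P \<circ> Q)"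
  \<comment> \<open>Exchanging factors preserves only nonzero spectral values, so a vanishing norm
    is treated apart.\<close>
  proof (cases "onorm R = 0")
    case True
    then show ?thesis by (simp add: spectral_radius_nonneg bounded_op_comp bP bQ)
  next
    case False
    then have pos: "0 < onorm R"
      using bounded_op_onorm_nonneg[OF bR] by simp
    have "complex_of_real (onorm R) \<in> op_spectrum ((P \<circ> b) \<circ> b)"
      by (rule op_spectrum_comp_commute[OF bb bounded_op_comp[OF bP bb]])
        (use pos onorm_in_spectrum[OF R pos] in \<open>auto simp: R_def\<close>)
    then have "complex_of_real (onorm R) \<in> op_spectrum (P \<circ> Q)"
      by (simp add: comp_assoc bbQ)
    then show ?thesis
      using cmod_spectrum_le_spectral_radius[OF bounded_op_comp[OF bP bQ]] pos by force
  qed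
  moreover have "(norm (op_sqrt P (b x)))\<^sup>2 \<le> onorm R * (norm x)\<^sup>2"
    unfolding norm_op_sqrt_sq[OF P] form[symmetric]
    by (rule form_le_norm[OF bounded_op_norm[OF bR]])
  ultimately have "(norm (op_sqrt P (b x)))\<^sup>2 \<le> spectral_radius (P \<circ> Q) * (norm x)\<^sup>2"
    by (meson mult_right_mono order_trans zero_le_power2)
  then show ?thesis
    unfolding b_def using real_sqrt_le_mono by (fastforce simp: real_sqrt_mult)
qed

text \<open>For the column operator \<open>V x = (a x, b x)\<close>, \<open>P + Q\<close> is
  \<open>V* V\<close>, while \<open>V V*\<close> has diagonal \<open>P\<close>, \<open>Q\<close> and
  off-diagonal entries \<open>a b\<close>, \<open>b a\<close>; bounding the latter bounds the
  former. In vectors, \<open>N = \<langle>a u + b v, x\<rangle>\<close> and Cauchy-Schwarz give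
  \<open>N\<^sup>2 <= (m + s) N (norm x)\<^sup>2\<close>, and one factor \<open>N\<close>
  cancels.\<close>

lemma positive_sum_form_le:
  assumes P: "positive_op P" and Q: "positive_op Q"
    and Pm: "\<And>x. norm (P x) \<le> m * norm x" and Qm: "\<And>x. norm (Q x) \<le> m * norm x"
  shows "Re (cinner (P x) x) + Re (cinner (Q x) x)
    \<le> (m + sqrt (spectral_radius (P \<circ> Q))) * (norm x)\<^sup>2"
proof -
  define s where "s = sqrt (spectral_radius (P \<circ> Q))"
  define a b where "a = op_sqrt P" and "b = op_sqrt Q"
  have a: "positive_op a" and b: "positive_op b"
    by (simp_all add: a_def b_def positive_op_op_sqrt P Q)
  define u v where "u = a x" and "v = b x"
  define N where "N = (norm u)\<^sup>2 + (norm v)\<^sup>2"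
  have s0: "0 \<le> s"
    by (simp add: s_def spectral_radius_nonneg bounded_op_comp positive_opD(1) P Q)
  have au: "(norm (a u))\<^sup>2 \<le> m * (norm u)\<^sup>2" and bv: "(norm (b v))\<^sup>2 \<le> m * (norm v)\<^sup>2"
    unfolding a_def b_def norm_op_sqrt_sq[OF P] norm_op_sqrt_sq[OF Q]
    using form_le_norm Pm Qm by blast+
  have "Re (cinner (a u) (b v)) \<le> norm u * norm (a (b v))"
    unfolding positive_op_symmetric[OF a]
    using cinner_Cauchy_Schwarz complex_Re_le_cmod order_trans by blast
  also have "\<dots> \<le> norm u * (s * norm v)"
    unfolding a_def b_def s_def
    by (rule mult_left_mono[OF norm_op_sqrt_comp_le[OF P Q]]) simp
  finally have "2 * Re (cinner (a u) (b v)) \<le> s * (2 * norm u * norm v)"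
    by (simp add: algebra_simps)
  also have "\<dots> \<le> s * N"
    unfolding N_def by (rule mult_left_mono[OF sum_squares_bound s0])
  finally have sum: "(norm (a u + b v))\<^sup>2 \<le> (m + s) * N"
    using au bv unfolding norm_add_sq by (simp add: N_def algebra_simps)
  have N: "N = Re (cinner (P x) x) + Re (cinner (Q x) x)"
    by (simp add: N_def u_def v_def a_def b_def norm_op_sqrt_sq P Q)
  have "N = Re (cinner (a u + b v) x)"
    by (simp add: N_def cinner_simps positive_op_symmetric[OF a, of u] positive_op_symmetric[OF b, of v]
        Re_cinner_self flip: u_def v_def)
  also have "\<dots> \<le> norm (a u + b v) * norm x"
    using cinner_Cauchy_Schwarz complex_Re_le_cmod order_trans by blast
  finally have "N\<^sup>2 \<le> (norm (a u + b v) * norm x)\<^sup>2"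
    by (rule power_mono) (simp add: N_def)
  also have "\<dots> \<le> ((m + s) * N) * (norm x)\<^sup>2"
    unfolding power_mult_distrib by (rule mult_right_mono[OF sum]) simp
  finally have NN: "N * N \<le> ((m + s) * (norm x)\<^sup>2) * N"
    by (simp add: power2_eq_square algebra_simps)
  have "N \<le> (m + s) * (norm x)\<^sup>2"
  proof (cases "N = 0")
    case True
    \<comment> \<open>The sign of \<open>m\<close> is visible only through
      \<open>m * norm x\<close>, which dominates a norm; this is enough here.\<close>
    have "0 \<le> m * norm x"
      using Pm[of x] norm_ge_zero order_trans by blast
    then have "0 \<le> m * norm x * norm x"
      by (rule mult_nonneg_nonneg) simp
    then have "0 \<le> m * (norm x)\<^sup>2"
      by (simp add: power2_eq_square mult.assoc)
    then show ?thesis using True s0 by (simp add: distrib_right)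
  next
    case False
    moreover have "0 \<le> N" by (simp add: N_def)
    ultimately show ?thesis using NN mult_le_cancel_right_pos[of N] by simp
  qed
  then show ?thesis by (simp add: N s_def)
qed

lemma sqrt_mult_sqrt_le: "0 \<le> p \<Longrightarrow> 0 \<le> q \<Longrightarrow> sqrt p * sqrt q \<le> (p + q) / 2"
  using arith_geo_mean_sqrt[of p q] by (simp add: real_sqrt_mult)

theorem mainTheorem1:
  fixes B C :: "'a::chilbert \<Rightarrow> 'a"
  assumes "bounded_op B" and "bounded_op C"
  shows "numerical_radius (block_op (\<lambda>_. 0) B C (\<lambda>_. 0))
    \<le> 1/2 * max (onorm B) (onorm C)
      + 1/2 * max (sqrt (spectral_radius (op_abs B \<circ> op_abs_adj C)))
                  (sqrt (spectral_radius (op_abs_adj B \<circ> op_abs C)))"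
proof -
  note B = assms(1) and C = assms(2)
  note pos = positive_op_op_abs[OF B] positive_op_op_abs[OF C]
    positive_op_op_abs_adj[OF B] positive_op_op_abs_adj[OF C]
  define m where "m = max (onorm B) (onorm C)"
  define s1 where "s1 = sqrt (spectral_radius (op_abs B \<circ> op_abs_adj C))"
  define s2 where "s2 = sqrt (spectral_radius (op_abs_adj B \<circ> op_abs C))"
  have le_m: "r \<le> m * norm x" if "r \<le> onorm B * norm x \<or> r \<le> onorm C * norm x"
    for r and x :: 'a
    using that mult_right_mono[of "onorm B" m "norm x"] mult_right_mono[of "onorm C" m "norm x"]
    by (auto simp: m_def)
  have bounds: "norm (op_abs B x) \<le> m * norm x" "norm (op_abs C x) \<le> m * norm x"
    "norm (op_abs_adj B x) \<le> m * norm x" "norm (op_abs_adj C x) \<le> m * norm x" for x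
    by (rule le_m, simp add: norm_op_abs norm_op_abs_adj B C bounded_op_norm norm_adjoint_le)+
  have "0 \<le> m" "0 \<le> s1"
    by (simp_all add: m_def s1_def le_max_iff_disj bounded_op_onorm_nonneg B spectral_radius_nonneg
        bounded_op_comp positive_opD(1) pos)
  show ?thesis
    unfolding numerical_radius_def m_def[symmetric] s1_def[symmetric] s2_def[symmetric]
  proof (rule cSup_least, simp, elim insertE)
    \<comment> \<open>The value 0 inserted into the supremum by \<open>numerical_radius\<close> must
      also lie below the bound.\<close>
    show "r \<le> 1/2 * m + 1/2 * max s1 s2" if "r = 0" for r
      using that \<open>0 \<le> m\<close> \<open>0 \<le> s1\<close> by simp
  next
    fix r assume "r \<in> {cmod (cinner (block_op (\<lambda>_. 0) B C (\<lambda>_. 0) p) p) |p. norm p = 1}"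
    then obtain x y where r: "r = cmod (cinner (block_op (\<lambda>_. 0) B C (\<lambda>_. 0) (x, y)) (x, y))"
      and "norm (x, y) = 1" by auto
    then have one: "(norm x)\<^sup>2 + (norm y)\<^sup>2 = 1"
      by (simp add: norm_prod_def)
    have mixed: "cmod (cinner (T u) v)
        \<le> (Re (cinner (op_abs T u) u) + Re (cinner (op_abs_adj T v) v)) / 2"
      if "bounded_op T" for T :: "'a \<Rightarrow> 'a" and u v
      using mixed_Schwarz[OF that, of u v]
        sqrt_mult_sqrt_le[OF positive_opD(2)[OF positive_op_op_abs[OF that], of u]
          positive_opD(2)[OF positive_op_op_abs_adj[OF that], of v]]
      by linarith
    have "r \<le> cmod (cinner (B y) x) + cmod (cinner (C x) y)"
      by (simp add: r block_op_def cinner_prod_def norm_triangle_ineq)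
    \<comment> \<open>Collecting the mixed Schwarz terms by vector pairs \<open>|B|\<close> with
      \<open>|C*|\<close> at \<open>y\<close> and \<open>|B*|\<close> with \<open>|C|\<close> at
      \<open>x\<close>, which fixes the two spectral radii. Passing to the larger one gives both
      forms the same constant, and the weights add up to 1.\<close>
    moreover have "Re (cinner (op_abs B y) y) + Re (cinner (op_abs_adj C y) y)
        \<le> (m + max s1 s2) * (norm y)\<^sup>2"
      by (rule order_trans[OF positive_sum_form_le[OF pos(1,4) bounds(1,4)] mult_right_mono])
        (simp_all add: s1_def)
    moreover have "Re (cinner (op_abs_adj B x) x) + Re (cinner (op_abs C x) x)
        \<le> (m + max s1 s2) * (norm x)\<^sup>2"
      by (rule order_trans[OF positive_sum_form_le[OF pos(3,2) bounds(3,2)] mult_right_mono])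
        (simp_all add: s2_def)
    moreover have "(m + max s1 s2) * (norm y)\<^sup>2 + (m + max s1 s2) * (norm x)\<^sup>2 = m + max s1 s2"
      using one by (metis add.commute distrib_left mult.right_neutral)
    ultimately show "r \<le> 1/2 * m + 1/2 * max s1 s2"
      using mixed[OF B, of y x] mixed[OF C, of x y] by argo
  qed
qed

end
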